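(* Let $n,p\in\mathbb N$, let $\lambda\ge\mu\ge 0$, $l\ge 0$, $\delta\ge0$ be real, let $-1\le A<B\le 1$, $0<B\le 1$, $0\le\sigma<p$, and let $0\le\nu<1$, $\vartheta>-p$ be real. Let $f(z)=z^p-\sum_{k=n+p}^\infty|a_k|z^k$ be in the class $\widetilde{\mathcal P}_{\lambda,\mu,l}^{\delta}(A,B;\sigma,p)$. Then for all $z\in\mathcal U$, $$\left|\mathcal D_z^{\nu}\{(\mathcal I_{\vartheta,p}f)(z)\}\right|\ge\left\{\frac{\Gamma(p+1)}{\Gamma(p+1-\nu)}-\frac{(\vartheta+p)\Gamma(n+p)(B-A)(p-\sigma)}{(\vartheta+n+p)\Gamma(n+p+1-\nu)(1+B)\Phi_p^{n+p}(\delta,\lambda,\mu,l)}|z|^n\right\}|z|^{p-\nu}$$ and $$\left|\mathcal D_z^{\nu}\{(\mathcal I_{\vartheta,p}f)(z)\}\right|\le\left\{\frac{\Gamma(p+1)}{\Gamma(p+1-\nu)}+\frac{(\vartheta+p)\Gamma(n+p)(B-A)(p-\sigma)}{(\vartheta+n+p)\Gamma(n+p+1-\nu)(1+B)\Phi_p^{n+p}(\delta,\lambda,\mu,l)}|z|^n\right\}|z|^{p-\nu}.$$ Each of these two assertions is sharp.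
   Context: $\mathbb N=\{1,2,3,\dots\}$ and $\mathcal U=\{z\in\mathbb C:|z|<1\}$. $\mathcal A(n,p)$ is the class of functions $f(z)=z^p+\sum_{k=n+p}^\infty a_kz^k$ that are analytic and $p$-valent in $\mathcal U$ ($p$-valent: no value is taken more than $p$ times in $\mathcal U$, counted with multiplicity, and some value is taken exactly $p$ times). For $k\ge n+p$ put $$\Phi_p^k(\delta,\lambda,\mu,l)=\left[\frac{(k-p)(\lambda\mu k+\lambda-\mu)+p+l}{p+l}\right]^{\delta},\qquad \mathcal J_p^\delta(\lambda,\mu,l)f(z)=z^p+\sum_{k=n+p}^\infty\Phi_p^k(\delta,\lambda,\mu,l)\,a_kz^k .$$ For $F,G$ analytic in $\mathcal U$, $F\prec G$ (subordination) means $F(z)=G(w(z))$ in $\mathcal U$ for some analytic $w:\mathcal U\to\mathbb C$ with $w(0)=0$, $|w(z)|<1$. The class $\mathcal P_{\lambda,\mu,l}^{\delta}(A,B;\sigma,p)$ consists of all $f\in\mathcal A(n,p)$ with $$\frac1{p-\sigma}\left(\frac{[\mathcal J_p^\delta(\lambda,\mu,l)f(z)]'}{z^{p-1}}-\sigma\right)\prec\frac{1+Az}{1+Bz}\quad(z\in\mathcal U)$$ (the quotient by $z^{p-1}$ being extended analytically to $z=0$), and $\widetilde{\mathcal P}_{\lambda,\mu,l}^{\delta}(A,B;\sigma,p)$ is the subclass of those $f$ of the form $f(z)=z^p-\sum_{k=n+p}^\infty|a_k|z^k$. Integral operator: for $\vartheta>-p$ and $f\in\mathcal A(n,p)$, $$(\mathcal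 I_{\vartheta,p}f)(z)=\frac{\vartheta+p}{z^{\vartheta}}\int_0^zt^{\vartheta-1}f(t)\,dt .$$ Fractional derivative of order $\nu$, $0\le\nu<1$, of a function $F$ analytic in a simply connected region containing the origin: $$\mathcal D_z^{\nu}F(z)=\frac1{\Gamma(1-\nu)}\frac{d}{dz}\int_0^z\frac{F(\zeta)}{(z-\zeta)^{\nu}}\,d\zeta,$$ where the multiplicity of $(z-\zeta)^{-\nu}$ is removed by requiring $\log(z-\zeta)$ to be real for $z-\zeta>0$ (the integral may be taken along the segment from $0$ to $z$, and the modulus of $\mathcal D_z^\nu F(z)$ does not depend on the branch); values at $z=0$ are understood as limits. "Sharp" means that there is a function in the class for which equality is attained at suitable points $z\ne0$ of $\mathcal U$. *)

theory Defs
  imports "HOL-Complex_Analysis.Complex_Analysis"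
begin

text \<open>The open unit disc is \<^term>\<open>ball 0 1\<close>.\<close>

definition value_count :: "(complex \<Rightarrow> complex) \<Rightarrow> complex set \<Rightarrow> complex \<Rightarrow> nat" where
  "value_count f S c = (\<Sum>z\<in>{z\<in>S. f z = c}. nat (zorder (\<lambda>w. f w - c) z))"

text \<open>A sum over an infinite set is \<open>0\<close>, hence the explicit finiteness condition.\<close>

definition p_valent :: "nat \<Rightarrow> (complex \<Rightarrow> complex) \<Rightarrow> complex set \<Rightarrow> bool" where
  "p_valent p f S \<longleftrightarrow>
     (\<forall>c. finite {z\<in>S. f z = c} \<and> value_count f S c \<le> p) \<and> (\<exists>c. value_count f S c = p)"

definition class_A :: "nat \<Rightarrow> nat \<Rightarrow> (complex \<Rightarrow> complex) set" where
  "class_A n p = {f. f holomorphic_on ball 0 1 \<and> p_valent p f (ball 0 1) \<and>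
     (\<exists>a :: nat \<Rightarrow> complex. \<forall>z\<in>ball 0 1. (\<lambda>j. a (n + p + j) * z ^ (n + p + j)) sums (f z - z ^ p))}"

definition Phi :: "nat \<Rightarrow> nat \<Rightarrow> real \<Rightarrow> real \<Rightarrow> real \<Rightarrow> real \<Rightarrow> real" where
  "Phi p k \<delta> lam \<mu> l =
     (((real k - real p) * (lam * \<mu> * real k + lam - \<mu>) + real p + l) / (real p + l)) powr \<delta>"

text \<open>The coefficients \<open>a\<^sub>k\<close> of \<open>f\<close> are its Taylor coefficients at the origin.\<close>

definition J_op :: "nat \<Rightarrow> nat \<Rightarrow> real \<Rightarrow> real \<Rightarrow> real \<Rightarrow> real \<Rightarrow> (complex \<Rightarrow> complex) \<Rightarrow> complex \<Rightarrow> complex" where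
  "J_op n p \<delta> lam \<mu> l f z = z ^ p +
     (\<Sum>j. of_real (Phi p (n + p + j) \<delta> lam \<mu> l) * fps_nth (fps_expansion f 0) (n + p + j) * z ^ (n + p + j))"

definition subordinate :: "(complex \<Rightarrow> complex) \<Rightarrow> (complex \<Rightarrow> complex) \<Rightarrow> bool" where
  "subordinate F G \<longleftrightarrow> F holomorphic_on ball 0 1 \<and> G holomorphic_on ball 0 1 \<and>
     (\<exists>w. w holomorphic_on ball 0 1 \<and> w 0 = 0 \<and>
       (\<forall>z\<in>ball 0 1. norm (w z) < 1 \<and> F z = G (w z)))"

text \<open>\<^const>\<open>remove_sings\<close> supplies the analytic extension of the quotient to the origin.\<close>

definition class_P ::
  "nat \<Rightarrow> nat \<Rightarrow> real \<Rightarrow> real \<Rightarrow> real \<Rightarrow> real \<Rightarrow> real \<Rightarrow> real \<Rightarrow> real \<Rightarrow> (complex \<Rightarrow> complex) set" where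
  "class_P n p \<delta> lam \<mu> l A B \<sigma> = {f \<in> class_A n p.
     subordinate
       (\<lambda>z. 1 / of_real (real p - \<sigma>) *
          (remove_sings (\<lambda>u. deriv (J_op n p \<delta> lam \<mu> l f) u / u ^ (p - 1)) z - of_real \<sigma>))
       (\<lambda>z. (1 + of_real A * z) / (1 + of_real B * z))}"

definition class_P_tilde ::
  "nat \<Rightarrow> nat \<Rightarrow> real \<Rightarrow> real \<Rightarrow> real \<Rightarrow> real \<Rightarrow> real \<Rightarrow> real \<Rightarrow> real \<Rightarrow> (complex \<Rightarrow> complex) set" where
  "class_P_tilde n p \<delta> lam \<mu> l A B \<sigma> = {f \<in> class_P n p \<delta> lam \<mu> l A B \<sigma>.
     \<exists>a :: nat \<Rightarrow> complex. \<forall>z\<in>ball 0 1.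
       (\<lambda>j. of_real (norm (a (n + p + j))) * z ^ (n + p + j)) sums (z ^ p - f z)}"

text \<open>
  The integral is taken along the segment from \<open>0\<close> to \<open>z\<close>, on which the principal arguments of
  \<open>t\<close> and \<open>z\<close> agree, so the branch of the powers cancels. At \<open>z = 0\<close> the right-hand side is
  \<open>0\<close>, which is the limit there for \<open>f \<in> class_A n p\<close> with \<open>p \<ge> 1\<close> and \<open>\<theta> > - p\<close>.
\<close>

definition I_op :: "real \<Rightarrow> nat \<Rightarrow> (complex \<Rightarrow> complex) \<Rightarrow> complex \<Rightarrow> complex" where
  "I_op \<theta> p f z = of_real (\<theta> + real p) / z powr of_real \<theta> *
     contour_integral (linepath 0 z) (\<lambda>t. t powr of_real (\<theta> - 1) * f t)"

text \<open>
  For \<open>w\<close> near \<open>z \<noteq> 0\<close> and \<open>\<zeta>\<close> on the segment from \<open>0\<close> to \<open>w\<close>, the power \<open>(w - \<zeta>)\<^sup>\<nu>\<close> is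
  written as \<open>z\<^sup>\<nu> ((w - \<zeta>) / z)\<^sup>\<nu>\<close> with principal values. This branch is the principal one when
  \<open>z\<close> is off the negative real axis (lemma \<open>frac_deriv_principal\<close>), and it remains analytic in
  \<open>w\<close> near \<open>z\<close> when \<open>z\<close> is a negative real, where the principal branch has its cut.
\<close>

definition frac_deriv_nz :: "real \<Rightarrow> (complex \<Rightarrow> complex) \<Rightarrow> complex \<Rightarrow> complex" where
  "frac_deriv_nz \<nu> F z = 1 / of_real (Gamma (1 - \<nu>)) *
     deriv (\<lambda>w. contour_integral (linepath 0 w)
       (\<lambda>\<zeta>. F \<zeta> / (z powr of_real \<nu> * ((w - \<zeta>) / z) powr of_real \<nu>))) z"

definition frac_deriv :: "real \<Rightarrow> (complex \<Rightarrow> complex) \<Rightarrow> complex \<Rightarrow> complex" where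
  "frac_deriv \<nu> F z = (if z = 0 then Lim (at 0) (frac_deriv_nz \<nu> F) else frac_deriv_nz \<nu> F z)"

lemma frac_deriv_principal:
  assumes z: "z \<notin> \<real>\<^sub>\<le>\<^sub>0"
  shows "frac_deriv \<nu> F z = 1 / of_real (Gamma (1 - \<nu>)) *
    deriv (\<lambda>w. contour_integral (linepath 0 w) (\<lambda>\<zeta>. F \<zeta> / (w - \<zeta>) powr of_real \<nu>)) z"
proof -
  have z0: "z \<noteq> 0" using z by auto
  have "((\<lambda>w. Im (Ln (w / z) + Ln z)) \<longlongrightarrow> Im (Ln (z / z) + Ln z)) (nhds z)"
    using z0 by (intro tendsto_intros filterlim_ident) auto
  then have tendsto: "((\<lambda>w. Im (Ln (w / z) + Ln z)) \<longlongrightarrow> Im (Ln z)) (nhds z)"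
    using z0 by simp
  have "- pi < Im (Ln z)" "Im (Ln z) < pi"
    using z z0 mpi_less_Im_Ln Im_Ln_le_pi[of z] Im_Ln_eq_pi[of z]
    by (auto simp: complex_nonpos_Reals_iff order.order_iff_strict)
  then have "\<forall>\<^sub>F w in nhds z. - pi < Im (Ln (w / z) + Ln z)" "\<forall>\<^sub>F w in nhds z. Im (Ln (w / z) + Ln z) < pi"
    using order_tendstoD[OF tendsto] by blast+
  moreover have "\<forall>\<^sub>F w in nhds z. w \<noteq> 0"
    using z0 t1_space_nhds by blast
  ultimately have "\<forall>\<^sub>F w in nhds z.
      contour_integral (linepath 0 w)
        (\<lambda>\<zeta>. F \<zeta> / (z powr of_real \<nu> * ((w - \<zeta>) / z) powr of_real \<nu>)) =
      contour_integral (linepath 0 w) (\<lambda>\<zeta>. F \<zeta> / (w - \<zeta>) powr of_real \<nu>)"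
  proof eventually_elim
    case (elim w)
    have "exp (Ln (w / z) + Ln z) = w"
      using elim z0 by (simp add: exp_add)
    then have L: "Ln w = Ln (w / z) + Ln z"
      using elim by (metis Ln_exp less_imp_le)
    show ?case
    proof (rule contour_integral_cong)
      fix \<zeta> assume "\<zeta> \<in> path_image (linepath 0 w)"
      then obtain s where s: "0 \<le> s" "s \<le> 1" "\<zeta> = of_real s * w"
        by (auto simp: in_segment scaleR_conv_of_real)
      show "F \<zeta> / (z powr of_real \<nu> * ((w - \<zeta>) / z) powr of_real \<nu>) = F \<zeta> / (w - \<zeta>) powr of_real \<nu>"
      proof (cases "s = 1")
        case False
        then have s1: "1 - s > 0" using s by auto
        have e: "w - \<zeta> = of_real (1 - s) * w" "(w - \<zeta>) / z = of_real (1 - s) * (w / z)"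
          using s by (auto simp: algebra_simps diff_divide_distrib)
        have "Ln (w - \<zeta>) = Ln z + Ln ((w - \<zeta>) / z)"
          unfolding e
          using L Ln_times_of_real[OF s1, of w] Ln_times_of_real[OF s1, of "w / z"] elim z0
          by simp
        then show ?thesis
          using s1 elim z0 by (auto simp: powr_def e exp_add ring_distribs)
      qed (simp add: s)
    qed auto
  qed
  then show ?thesis
    unfolding frac_deriv_def frac_deriv_nz_def using z0 by (auto intro: deriv_cong_ev)
qed

end

theory Submission
  imports Defs
begin

text \<open>
  Both operators act diagonally on power series. The substitution \<open>t = x z\<close> turns the integral
  operator, and the integral inside the fractional derivative, into Beta integrals over \<open>[0, 1]\<close>,
  so that \<open>z ^ k\<close> is multiplied by \<open>(\<theta> + p) / (\<theta> + k)\<close> and then sent to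
  \<open>\<Gamma>(k + 1) / \<Gamma>(k + 1 - \<nu>) z ^ (k - \<nu>)\<close>. Hence for \<open>f(z) = z ^ p - \<Sum>\<^sub>j m\<^sub>j z ^ (n + p + j)\<close> with
  \<open>m\<^sub>j \<ge> 0\<close> the quotient of \<open>D\<^sup>\<nu> (I f) (z)\<close> by \<open>z ^ p / z powr \<nu>\<close> is
  \<open>C0 - T(z)\<close>, where \<open>T(z)\<close> is a power series starting at \<open>z ^ n\<close> with nonnegative coefficients
  (\<open>frac_deriv_I_op_sums\<close>), and everything reduces to \<open>\<bar>T(z)\<bar> \<le> C1 \<bar>z\<bar> ^ n\<close>.

  That inequality is a coefficient estimate. For \<open>h = 1 - F\<close>, where \<open>F\<close> is the function that is
  subordinate to \<open>(1 + A z) / (1 + B z)\<close>, the value \<open>h = (B - A) / (1 + B)\<close> at some point would force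
  the subordinating function to be \<open>1\<close> there, which it never is. As the \<open>m\<^sub>j\<close> are real, \<open>h\<close> is real on
  \<open>[0, 1)\<close> and vanishes at \<open>0\<close>, so by continuity it stays below that value; as the \<open>m\<^sub>j\<close>
  are nonnegative, letting the real variable tend to \<open>1\<close> bounds \<open>\<Sum>\<^sub>j k \<Phi>\<^sub>k m\<^sub>j\<close>, with \<open>k = n + p + j\<close>, by
  \<open>(B - A) (p - \<sigma>) / (1 + B)\<close> (\<open>class_P_tilde_coeff_bound\<close>). The multipliers of the two operators,
  divided by \<open>k \<Phi>\<^sub>k\<close>, do not increase with \<open>k\<close>, so the index \<open>k = n + p\<close> gives the largest ratio
  (\<open>DI_coeff_le\<close>).

  Equality holds for the trinomial \<open>z ^ p - c z ^ (n + p)\<close> whose single coefficient exhausts the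
  coefficient bound: the lower estimate is attained at small positive \<open>z\<close>, the upper one
  where \<open>z ^ n\<close> is negative. The real work is to see that this trinomial belongs to the class, in
  particular that it is \<open>p\<close>-valent. Since \<open>c (n + p) \<le> p\<close>, it is starlike: it is the \<open>p\<close>-th power of
  \<open>g(z) = z (1 - c z ^ n) ^ (1 / p)\<close>, and in the coordinate \<open>s = Ln z\<close> the logarithm of \<open>g\<close> has a
  derivative with positive real part on the half-plane \<open>Re s < 0\<close>. By convexity it is injective
  there, so \<open>g\<close> is injective on the disc (\<open>trinomial_root_inj_on\<close>), and each of the \<open>p\<close> roots of
  \<open>\<zeta> ^ p = v\<close> is taken at most once by \<open>g\<close>.
\<close>

section \<open>Integral operators on power series\<close>

text \<open>
  The common source of both multiplier formulas: against a Beta weight, a series that converges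
  absolutely on \<open>[0, 1]\<close> may be integrated term by term, because the weight times the sum of the
  norms of the coefficients is an integrable majorant. The second part holds because the Beta
  integrals decrease in \<open>j\<close>.
\<close>
lemma has_integral_Beta_powser:
  fixes d :: "nat \<Rightarrow> complex" and a b :: real
  assumes "a > 0" "b > 0" and d: "summable (\<lambda>j. norm (d j))"
  shows "((\<lambda>x. of_real (x powr (a - 1) * (1 - x) powr (b - 1)) * (\<Sum>j. d j * of_real x ^ j))
           has_integral (\<Sum>j. d j * of_real (Beta (a + real j) b))) {0..1}"
    and "summable (\<lambda>j. norm (d j * of_real (Beta (a + real j) b)))"
proof -
  define w where "w = (\<lambda>x::real. x powr (a - 1) * (1 - x) powr (b - 1))"
  have w_nonneg: "w x \<ge> 0" for x
    by (simp add: w_def)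
  have w_int: "(w has_integral Beta a b) {0..1}"
    unfolding w_def by (rule has_integral_Beta_real) (use assms in auto)
  have int: "((\<lambda>x. w x * x ^ j) has_integral Beta (a + real j) b) {0..1}" for j
  proof -
    have "((\<lambda>x. x powr (a + real j - 1) * (1 - x) powr (b - 1)) has_integral Beta (a + real j) b) {0..1}"
      by (rule has_integral_Beta_real) (use assms in auto)
    moreover have "x powr (a + real j - 1) * (1 - x) powr (b - 1) = w x * x ^ j" if "x \<in> {0..1}" for x
    proof (cases "x = 0")
      case False
      then have "x powr (a + real j - 1) = x powr (a - 1) * x ^ j"
        using that by (simp add: powr_realpow[symmetric] powr_add[symmetric] algebra_simps)
      then show ?thesis by (simp add: w_def)
    qed (simp add: w_def)
    ultimately show ?thesis
      using has_integral_cong by (metis (no_types, lifting))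
  qed
  have Beta_nonneg: "Beta (a + real j) b \<ge> 0" for j
    by (rule has_integral_nonneg[OF int]) (simp add: w_nonneg)
  have Beta_le: "Beta (a + real j) b \<le> Beta a b" for j
    by (rule has_integral_le[OF int w_int])
       (auto intro!: mult_left_le power_le_one simp: w_nonneg)
  show sm: "summable (\<lambda>j. norm (d j * of_real (Beta (a + real j) b)))"
  proof (rule summable_comparison_test'[OF summable_mult2[OF d, of "Beta a b"]])
    show "norm (norm (d j * of_real (Beta (a + real j) b))) \<le> norm (d j) * Beta a b" if "j \<ge> 0" for j
      using Beta_le[of j] Beta_nonneg[of j] by (auto simp: norm_mult intro!: mult_left_mono)
  qed
  have term_bound: "norm (d j * of_real x ^ j) \<le> norm (d j)" if "x \<in> {0..1::real}" for j x
    using that by (auto simp: norm_mult norm_power intro!: mult_left_le power_le_one)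
  have "((\<lambda>x. of_real (w x) * (\<Sum>j. d j * of_real x ^ j))
           has_integral (\<Sum>j. d j * of_real (Beta (a + real j) b))) {0..1}"
  proof (rule has_integral_dominated_convergence)
    fix N :: nat
    have "((\<lambda>x. d j * of_real (w x * x ^ j)) has_integral d j * of_real (Beta (a + real j) b)) {0..1}" for j
      using has_integral_mult_right[OF has_integral_linear[OF int bounded_linear_of_real], of "d j"]
      by (simp add: o_def)
    then have "((\<lambda>x. \<Sum>j<N. d j * of_real (w x * x ^ j)) has_integral
        (\<Sum>j<N. d j * of_real (Beta (a + real j) b))) {0..1}"
      by (intro has_integral_sum) auto
    then show "((\<lambda>x. of_real (w x) * (\<Sum>j<N. d j * of_real x ^ j)) has_integral
        (\<Sum>j<N. d j * of_real (Beta (a + real j) b))) {0..1}"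
      by (simp add: sum_distrib_left mult_ac)
  next
    show "(\<lambda>x. w x * (\<Sum>j. norm (d j))) integrable_on {0..1}"
      using w_int has_integral_mult_left by blast
  next
    fix N :: nat
    show "\<forall>x\<in>{0..1}. norm (of_real (w x) * (\<Sum>j<N. d j * complex_of_real x ^ j)) \<le> w x * (\<Sum>j. norm (d j))"
    proof
      fix x :: real assume x: "x \<in> {0..1}"
      have "norm (\<Sum>j<N. d j * complex_of_real x ^ j) \<le> (\<Sum>j<N. norm (d j))"
        by (rule order_trans[OF norm_sum]) (use term_bound[OF x] in \<open>auto intro: sum_mono\<close>)
      also have "\<dots> \<le> (\<Sum>j. norm (d j))"
        by (rule sum_le_suminf[OF d]) auto
      finally show "norm (of_real (w x) * (\<Sum>j<N. d j * complex_of_real x ^ j)) \<le> w x * (\<Sum>j. norm (d j))"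
        using w_nonneg[of x] by (auto simp: norm_mult intro!: mult_left_mono)
    qed
  next
    show "\<forall>x\<in>{0..1}. (\<lambda>N. of_real (w x) * (\<Sum>j<N. d j * complex_of_real x ^ j)) \<longlonglongrightarrow>
        of_real (w x) * (\<Sum>j. d j * complex_of_real x ^ j)"
    proof
      fix x :: real assume x: "x \<in> {0..1}"
      have "summable (\<lambda>j. d j * complex_of_real x ^ j)"
        by (rule summable_comparison_test'[OF d]) (use term_bound[OF x] in auto)
      then show "(\<lambda>N. of_real (w x) * (\<Sum>j<N. d j * complex_of_real x ^ j)) \<longlonglongrightarrow>
        of_real (w x) * (\<Sum>j. d j * complex_of_real x ^ j)"
        by (intro tendsto_intros summable_LIMSEQ)
    qed
  next
    show "(\<lambda>N. \<Sum>j<N. d j * of_real (Beta (a + real j) b)) \<longlonglongrightarrow> (\<Sum>j. d j * of_real (Beta (a + real j) b))"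
      by (rule summable_LIMSEQ[OF summable_norm_cancel[OF sm]])
  qed
  then show "((\<lambda>x. of_real (x powr (a - 1) * (1 - x) powr (b - 1)) * (\<Sum>j. d j * of_real x ^ j))
           has_integral (\<Sum>j. d j * of_real (Beta (a + real j) b))) {0..1}"
    by (simp add: w_def)
qed

lemma sums_imp_norm_summable_on_ball:
  fixes c :: "nat \<Rightarrow> complex"
  assumes "\<And>t. t \<in> ball 0 1 \<Longrightarrow> summable (\<lambda>j. c j * t ^ j)" and z: "z \<in> ball 0 1"
  shows "summable (\<lambda>j. norm (c j * z ^ j))"
proof -
  obtain r where r: "norm z < r" "r < 1" using z dense by auto
  have "r \<ge> 0" using r(1) by (meson norm_ge_zero less_imp_le order_trans)
  then show ?thesis
    by (intro powser_insidea[of c "of_real r"] assms) (use r in auto)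
qed

lemma powser_deriv_sums:
  fixes c :: "nat \<Rightarrow> complex"
  assumes c: "\<And>t. t \<in> ball 0 1 \<Longrightarrow> (\<lambda>j. c j * t ^ j) sums g t" and z: "z \<in> ball 0 1"
  shows "(g has_field_derivative deriv g z) (at z)"
    and "(\<lambda>j. of_nat j * c j * z ^ j) sums (z * deriv g z)"
proof -
  have sm: "summable (\<lambda>j. c j * t ^ j)" if "norm t < 1" for t
    using c[of t] that by (auto simp: sums_iff)
  have "((\<lambda>t. \<Sum>j. c j * t ^ j) has_field_derivative (\<Sum>j. diffs c j * z ^ j)) (at z)"
    by (rule termdiffs_strong'[of 1]) (use sm z in auto)
  then have D: "(g has_field_derivative (\<Sum>j. diffs c j * z ^ j)) (at z)"
    by (rule has_field_derivative_transform_within_open[of _ _ _ "ball 0 1"])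
       (use c z in \<open>auto simp: sums_iff\<close>)
  then have e: "deriv g z = (\<Sum>j. diffs c j * z ^ j)" by (rule DERIV_imp_deriv)
  show "(g has_field_derivative deriv g z) (at z)" using D e by simp
  have "summable (\<lambda>j. diffs c j * z ^ j)"
    by (rule termdiff_converges[of _ 1]) (use sm z in auto)
  then have "(\<lambda>j. of_nat j * c j * z ^ (j - Suc 0)) sums deriv g z"
    unfolding e by (rule diffs_equiv)
  then have "(\<lambda>j. z * (of_nat j * c j * z ^ (j - Suc 0))) sums (z * deriv g z)"
    by (rule sums_mult)
  moreover have "z * (of_nat j * c j * z ^ (j - Suc 0)) = of_nat j * c j * z ^ j" for j
    by (cases j) auto
  ultimately show "(\<lambda>j. of_nat j * c j * z ^ j) sums (z * deriv g z)" by simp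
qed

lemma power_factor_sums:
  fixes z :: complex
  assumes "(\<lambda>j. c j * z ^ (q + j)) sums s"
  shows "s = z ^ q * (\<Sum>j. c j * z ^ j)" "z \<noteq> 0 \<Longrightarrow> summable (\<lambda>j. c j * z ^ j)"
proof -
  have a: "(\<lambda>j. z ^ q * (c j * z ^ j)) sums s"
    using assms by (simp add: power_add mult_ac)
  show sm: "summable (\<lambda>j. c j * z ^ j)" if "z \<noteq> 0"
    using sums_mult[OF a, of "inverse (z ^ q)"] that by (auto simp: sums_iff mult.assoc[symmetric])
  show "s = z ^ q * (\<Sum>j. c j * z ^ j)"
  proof (cases "z = 0")
    case False
    then show ?thesis using a suminf_mult[OF sm, of "z ^ q"] by (simp add: sums_iff)
  next
    case True
    then show ?thesis
      using assms sums_unique[OF assms]  by (cases "q = 0") (auto simp: power_0_left)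
  qed
qed

text \<open>
  On the segment \<open>t = x z\<close> the factor \<open>z powr (\<theta> - 1) * z\<close> cancels the prefactor \<open>1 / z powr \<theta>\<close>;
  what remains is the Beta weight with parameters \<open>\<theta> + q\<close> and \<open>1\<close>, whose moments are
  \<open>1 / (\<theta> + q + j)\<close>. Taking out \<open>t ^ q\<close> first makes the first parameter positive even for
  negative \<open>\<theta>\<close>.
\<close>
lemma I_op_powser:
  assumes f: "\<And>t. t \<in> ball 0 1 \<Longrightarrow> (\<lambda>j. e j * t ^ (q + j)) sums f t"
    and "\<theta> > - real q" "q \<ge> 1" and z: "z \<in> ball 0 1"
  shows "(\<lambda>j. of_real ((\<theta> + real q) / (\<theta> + real q + real j)) * e j * z ^ (q + j)) sums I_op \<theta> q f z"
proof (cases "z = 0")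
  case True
  have "q \<noteq> 0" using \<open>q \<ge> 1\<close> by simp
  then show ?thesis using True by (simp add: I_op_def power_0_left)
next
  case False
  have "summable (\<lambda>j. e j * t ^ j)" if "t \<in> ball 0 1" for t
    by (cases "t = 0") (use power_factor_sums(2)[OF f[OF that]] in auto)
  then have d: "summable (\<lambda>j. norm (e j * z ^ j))"
    by (rule sums_imp_norm_summable_on_ball) (use z in auto)
  have Beta: "Beta (\<theta> + real q + real j) 1 = 1 / (\<theta> + real q + real j)" for j
  proof -
    have "\<theta> + real q + real j > 0" using assms(2) by simp
    then have "Gamma (\<theta> + real q + real j) > 0"
      "Gamma (\<theta> + real q + real j + 1) = (\<theta> + real q + real j) * Gamma (\<theta> + real q + real j)"
      by (auto intro!: Gamma_real_pos Gamma_plus1 simp: nonpos_Ints_def)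
    then show ?thesis by (simp add: Beta_def)
  qed
  have a: "\<theta> + real q > 0" using assms by simp
  note B = has_integral_Beta_powser[OF a zero_less_one d]
  define S where "S = (\<Sum>j. e j * z ^ j * of_real (Beta (\<theta> + real q + real j) 1))"
  have "((\<lambda>t. t powr of_real (\<theta> - 1) * f t) has_contour_integral z powr of_real \<theta> * z ^ q * S) (linepath 0 z)"
    unfolding has_contour_integral_linepath
  \<comment> \<open>At \<open>x = 1\<close> the Beta weight is \<open>0 powr 0 = 0\<close>, whereas the integrand may be nonzero.\<close>
  proof (rule has_integral_spike_finite[of "{1}"])
    show "((\<lambda>x. z powr of_real \<theta> * z ^ q * (of_real (x powr (\<theta> + real q - 1) * (1 - x) powr (1 - 1)) *
        (\<Sum>j. e j * z ^ j * of_real x ^ j))) has_integral z powr of_real \<theta> * z ^ q * S) {0..1}"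
      unfolding S_def by (intro has_integral_mult_right B)
    fix x :: real assume "x \<in> {0..1} - {1}"
    then have x: "x \<in> {0..1}" and x1: "x \<noteq> 1" by auto
    have l: "linepath 0 z x = of_real x * z" by (simp add: linepath_def scaleR_conv_of_real)
    have n: "norm (of_real x * z) < 1"
      using x z mult_mono[of "\<bar>x\<bar>" 1 "norm z" "norm z"] by (auto simp: norm_mult)
    have fx: "f (of_real x * z) = of_real x ^ q * z ^ q * (\<Sum>j. e j * z ^ j * of_real x ^ j)"
      using power_factor_sums(1)[OF f[of "of_real x * z"]] n by (simp add: power_mult_distrib mult_ac)
    have zt: "z powr of_real \<theta> = z powr of_real (\<theta> - 1) * z"
      using False by (simp add: powr_diff)
    show "linepath 0 z x powr of_real (\<theta> - 1) * f (linepath 0 z x) * (z - 0) =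
        z powr of_real \<theta> * z ^ q * (of_real (x powr (\<theta> + real q - 1) * (1 - x) powr (1 - 1)) *
        (\<Sum>j. e j * z ^ j * of_real x ^ j))"
    proof (cases "x = 0")
      case True
      then show ?thesis using fx \<open>q \<ge> 1\<close> zt by (auto simp: linepath_def)
    next
      case nx: False
      have "x powr (\<theta> + real q - 1) = x powr (\<theta> - 1) * x ^ q"
        using x nx by (simp add: powr_realpow[symmetric] powr_add[symmetric] algebra_simps)
      moreover have "(of_real x * z) powr of_real (\<theta> - 1) = of_real (x powr (\<theta> - 1)) * z powr of_real (\<theta> - 1)"
        using x by (subst powr_times_real_left) (auto simp: powr_of_real[symmetric])
      ultimately show ?thesis using nx x x1
        unfolding l fx zt by (simp add: mult_ac)
    qed
  qed simp
  then have "I_op \<theta> q f z = of_real (\<theta> + real q) * z ^ q * S"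
    using False by (simp add: I_op_def contour_integral_unique)
  moreover have "(\<lambda>j. of_real (\<theta> + real q) * z ^ q * (e j * z ^ j * of_real (Beta (\<theta> + real q + real j) 1)))
      sums (of_real (\<theta> + real q) * z ^ q * S)"
    unfolding S_def by (rule sums_mult[OF summable_sums[OF summable_norm_cancel[OF B(2)]]])
  ultimately show ?thesis
    unfolding Beta by (simp add: power_add mult_ac)
qed

text \<open>
  For \<open>w\<close> near \<open>z\<close> the kernel on the segment \<open>\<zeta> = x w\<close> splits as a constant times
  \<open>(1 - x) powr (- \<nu>) * (w / z) powr (- \<nu>)\<close>, which leaves a Beta integral in \<open>x\<close>. The power of
  \<open>w / z\<close> is differentiated at \<open>w / z = 1\<close>, away from the branch cut for every \<open>z \<noteq> 0\<close>; together
  with the factor \<open>w ^ (q + 1 + j)\<close> it yields \<open>q + j + 1 - \<nu>\<close>, which turns the Beta value into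
  the stated quotient of Gamma values.
\<close>
lemma frac_deriv_nz_powser:
  assumes F: "\<And>t. t \<in> ball 0 1 \<Longrightarrow> (\<lambda>j. e j * t ^ (q + j)) sums F t"
    and \<nu>: "\<nu> < 1" and q: "q \<ge> 1" and z: "z \<in> ball 0 1" "z \<noteq> 0"
  shows "(\<lambda>j. of_real (Gamma (real (q + j) + 1) / Gamma (real (q + j) + 1 - \<nu>)) * e j * z ^ (q + j))
    sums (z powr of_real \<nu> * frac_deriv_nz \<nu> F z)"
proof -
  define b where "b = (\<lambda>j. Beta (real q + 1 + real j) (1 - \<nu>))"
  define P where "P = (\<lambda>w. \<Sum>j. e j * of_real (b j) * w ^ j)"
  have sm: "summable (\<lambda>j. e j * t ^ j)" if "t \<in> ball 0 1" for t
    by (cases "t = 0") (use power_factor_sums(2)[OF F[OF that]] in auto)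
  have B: "((\<lambda>x. of_real (x powr (real q + 1 - 1) * (1 - x) powr (1 - \<nu> - 1)) * (\<Sum>j. e j * w ^ j * of_real x ^ j))
           has_integral P w) {0..1}" 
    and B': "(\<lambda>j. e j * of_real (b j) * w ^ j) sums P w" if w: "w \<in> ball 0 1" for w
  proof -
    have d: "summable (\<lambda>j. norm (e j * w ^ j))"
      by (rule sums_imp_norm_summable_on_ball[OF sm]) (use w in auto)
    have "real q + 1 > 0" "1 - \<nu> > 0" using \<nu> by auto
    note * = has_integral_Beta_powser[OF this d]
    show "((\<lambda>x. of_real (x powr (real q + 1 - 1) * (1 - x) powr (1 - \<nu> - 1)) * (\<Sum>j. e j * w ^ j * of_real x ^ j))
           has_integral P w) {0..1}"
      using *(1) by (simp add: P_def b_def mult_ac)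
    show "(\<lambda>j. e j * of_real (b j) * w ^ j) sums P w"
      using summable_sums[OF summable_norm_cancel[OF *(2)]] by (simp add: P_def b_def mult_ac)
  qed
  define CI where "CI = (\<lambda>w. contour_integral (linepath 0 w)
       (\<lambda>\<zeta>. F \<zeta> / (z powr of_real \<nu> * ((w - \<zeta>) / z) powr of_real \<nu>)))"
  have CI: "CI w = inverse (z powr of_real \<nu>) * ((w / z) powr of_real (- \<nu>) * (w ^ (q + 1) * P w))"
    if w: "w \<in> ball 0 1" for w
  proof -
    have "((\<lambda>\<zeta>. F \<zeta> / (z powr of_real \<nu> * ((w - \<zeta>) / z) powr of_real \<nu>)) has_contour_integral
        inverse (z powr of_real \<nu>) * ((w / z) powr of_real (- \<nu>)) * w ^ (q + 1) * P w) (linepath 0 w)"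
      unfolding has_contour_integral_linepath
    proof (rule has_integral_eq)
      show "((\<lambda>x. inverse (z powr of_real \<nu>) * ((w / z) powr of_real (- \<nu>)) * w ^ (q + 1) *
          (of_real (x powr (real q + 1 - 1) * (1 - x) powr (1 - \<nu> - 1)) * (\<Sum>j. e j * w ^ j * of_real x ^ j)))
        has_integral inverse (z powr of_real \<nu>) * ((w / z) powr of_real (- \<nu>)) * w ^ (q + 1) * P w) {0..1}"
        by (intro has_integral_mult_right B w)
      fix x :: real assume x: "x \<in> {0..1}"
      have l: "linepath 0 w x = of_real x * w" by (simp add: linepath_def scaleR_conv_of_real)
      have n: "norm (of_real x * w) < 1"
        using x w mult_mono[of "\<bar>x\<bar>" 1 "norm w" "norm w"] by (auto simp: norm_mult)
      have Fx: "F (of_real x * w) = of_real x ^ q * w ^ q * (\<Sum>j. e j * w ^ j * of_real x ^ j)"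
        using power_factor_sums(1)[OF F[of "of_real x * w"]] n by (simp add: power_mult_distrib mult_ac)
      have d: "(w - of_real x * w) / z = of_real (1 - x) * (w / z)" by (simp add: algebra_simps diff_divide_distrib)
      have p: "(of_real (1 - x) * (w / z)) powr of_real \<nu> = of_real ((1 - x) powr \<nu>) * (w / z) powr of_real \<nu>"
        using x by (subst powr_times_real_left) (auto simp: powr_of_real[symmetric])
      have xq: "x powr (real q + 1 - 1) = x ^ q"
        using q x by (cases "x = 0") (auto simp: powr_realpow)
      have i: "(1 - x) powr (1 - \<nu> - 1) = inverse ((1 - x) powr \<nu>)"
        by (simp add: powr_minus)
      show "inverse (z powr of_real \<nu>) * ((w / z) powr of_real (- \<nu>)) * w ^ (q + 1) *
          (of_real (x powr (real q + 1 - 1) * (1 - x) powr (1 - \<nu> - 1)) * (\<Sum>j. e j * w ^ j * of_real x ^ j)) =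
          F (linepath 0 w x) / (z powr of_real \<nu> * ((w - linepath 0 w x) / z) powr of_real \<nu>) * (w - 0)"
        unfolding l d p Fx xq i of_real_minus powr_minus by (simp add: field_simps)
    qed
    then show ?thesis by (simp add: CI_def contour_integral_unique mult.assoc)
  qed
  note PD = powser_deriv_sums[OF B' z(1)]
  \<comment> \<open>Differentiating \<open>w ^ (q + 1)\<close> and \<open>(w / z) powr (- \<nu>)\<close> produces \<open>q + 1 - \<nu>\<close>.\<close>
  have zq: "z ^ q = z * z ^ (q - Suc 0)"
    using q by (cases q) auto
  have "((\<lambda>w. inverse (z powr of_real \<nu>) * ((w / z) powr of_real (- \<nu>) * (w ^ (q + 1) * P w)))
     has_field_derivative inverse (z powr of_real \<nu>) *
       ((of_nat (q + 1) - of_real \<nu>) * z ^ q * P z + z ^ q * (z * deriv P z))) (at z)"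
    using z by (auto intro!: derivative_eq_intros PD(1) simp: field_simps zq)
  then have "(CI has_field_derivative inverse (z powr of_real \<nu>) *
       ((of_nat (q + 1) - of_real \<nu>) * z ^ q * P z + z ^ q * (z * deriv P z))) (at z)"
    by (rule has_field_derivative_transform_within_open[of _ _ _ "ball 0 1"]) (use z CI in auto)
  then have "z powr of_real \<nu> * frac_deriv_nz \<nu> F z = 1 / of_real (Gamma (1 - \<nu>)) *
       ((of_nat (q + 1) - of_real \<nu>) * z ^ q * P z + z ^ q * (z * deriv P z))"
    using z by (simp add: frac_deriv_nz_def CI_def[symmetric] DERIV_imp_deriv)
  moreover have "(\<lambda>j. 1 / of_real (Gamma (1 - \<nu>)) * ((of_nat (q + 1) - of_real \<nu>) * z ^ q * (e j * of_real (b j) * z ^ j)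
       + z ^ q * (of_nat j * (e j * of_real (b j)) * z ^ j))) sums
      (1 / of_real (Gamma (1 - \<nu>)) * ((of_nat (q + 1) - of_real \<nu>) * z ^ q * P z + z ^ q * (z * deriv P z)))"
    by (intro sums_mult sums_add PD(2) B' z)
  moreover have "1 / of_real (Gamma (1 - \<nu>)) * ((of_nat (q + 1) - of_real \<nu>) * z ^ q * (e j * of_real (b j) * z ^ j)
       + z ^ q * (of_nat j * (e j * of_real (b j)) * z ^ j)) =
      of_real (Gamma (real (q + j) + 1) / Gamma (real (q + j) + 1 - \<nu>)) * e j * z ^ (q + j)" for j
  proof -
    define x where "x = real (q + j) + 1 - \<nu>"
    have x: "x > 0" using \<nu> by (simp add: x_def)
    have "Gamma (x + 1) = x * Gamma x" using x by (intro Gamma_plus1) (auto simp: nonpos_Ints_def)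
    moreover have "real q + 1 + real j + (1 - \<nu>) = x + 1" by (simp add: x_def)
    moreover have "real q + 1 + real j = real (q + j) + 1" by simp
    ultimately have bj: "b j = Gamma (real (q + j) + 1) * Gamma (1 - \<nu>) / (x * Gamma x)"
      by (simp only: b_def Beta_def)
    have "Gamma (1 - \<nu>) > 0" using \<nu> by simp
    then have G: "b j * x / Gamma (1 - \<nu>) = Gamma (real (q + j) + 1) / Gamma x"
      unfolding bj using x by simp
    have "1 / of_real (Gamma (1 - \<nu>)) * ((of_nat (q + 1) - of_real \<nu>) * z ^ q * (e j * of_real (b j) * z ^ j)
       + z ^ q * (of_nat j * (e j * of_real (b j)) * z ^ j)) = of_real (b j * x / Gamma (1 - \<nu>)) * e j * z ^ (q + j)"
      by (simp add: x_def field_simps power_add)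
    also have "\<dots> = of_real (Gamma (real (q + j) + 1) / Gamma (real (q + j) + 1 - \<nu>)) * e j * z ^ (q + j)"
      unfolding G by (simp add: x_def)
    finally show ?thesis .
  qed
  ultimately show ?thesis by simp
qed

section \<open>Power series with a gap\<close>

text \<open>
  The coefficients of \<open>1 - \<Sum>\<^sub>j m\<^sub>j z ^ (n + j)\<close>, by which the function
  \<open>z ^ p - \<Sum>\<^sub>j m\<^sub>j z ^ (n + p + j)\<close> becomes a single series in the powers \<open>z ^ (p + j)\<close>.
\<close>
definition gap_coeff :: "nat \<Rightarrow> (nat \<Rightarrow> real) \<Rightarrow> nat \<Rightarrow> complex" where
  "gap_coeff n m j = (if j = 0 then 1 else if j < n then 0 else - of_real (m (j - n)))"

text \<open>
  Stated for an arbitrary sequence \<open>g\<close>, so that it transports every diagonal operator: with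
  \<open>g j\<close> the image of the monomial \<open>z ^ (p + j)\<close>, it passes between the image of the single series
  and the image of its tail.
\<close>
lemma gap_sums_iff:
  assumes "n \<ge> 1"
  shows "(\<lambda>j. of_real (m j) * g (n + j)) sums s \<longleftrightarrow> (\<lambda>j. gap_coeff n m j * g j) sums (g 0 - s)"
proof -
  have "(\<Sum>j<n. gap_coeff n m j * g j) = (\<Sum>j\<in>{0}. gap_coeff n m j * g j)"
    by (rule sum.mono_neutral_right) (use assms in \<open>auto simp: gap_coeff_def\<close>)
  then have "(\<lambda>j. gap_coeff n m j * g j) sums (g 0 - s) \<longleftrightarrow>
      (\<lambda>j. gap_coeff n m (j + n) * g (j + n)) sums (- s)"
    using sums_iff_shift[of "\<lambda>j. gap_coeff n m j * g j" n "- s"] by (simp add: gap_coeff_def add_ac)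
  also have "(\<lambda>j. gap_coeff n m (j + n) * g (j + n)) = (\<lambda>j. - (of_real (m j) * g (n + j)))"
    using assms by (auto simp: gap_coeff_def add_ac)
  also have "\<dots> sums (- s) \<longleftrightarrow> (\<lambda>j. of_real (m j) * g (n + j)) sums s"
    using sums_minus[of "\<lambda>j. of_real (m j) * g (n + j)" s] sums_minus[of "\<lambda>j. - (of_real (m j) * g (n + j))" "- s"] by auto
  finally show ?thesis by simp
qed

lemma shifted_powser_sums_iff:
  fixes t :: complex
  shows "(\<lambda>k. (if k < q then 0 else c (k - q)) * t ^ k) sums s \<longleftrightarrow> (\<lambda>j. c j * t ^ (q + j)) sums s"
proof -
  let ?h = "\<lambda>k. (if k < q then 0 else c (k - q)) * t ^ k"
  have "?h sums s \<longleftrightarrow> (\<lambda>j. ?h (j + q)) sums s"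
    using sums_iff_shift[of ?h q s] by simp
  also have "(\<lambda>j. ?h (j + q)) = (\<lambda>j. c j * t ^ (q + j))"
    by (simp add: add_ac)
  finally show ?thesis .
qed

lemma shifted_powser_deriv_sums:
  fixes c :: "nat \<Rightarrow> complex"
  assumes c: "\<And>t. t \<in> ball 0 1 \<Longrightarrow> (\<lambda>j. c j * t ^ (q + j)) sums g t" and z: "z \<in> ball 0 1"
  shows "(g has_field_derivative deriv g z) (at z)"
    and "(\<lambda>j. of_nat (q + j) * c j * z ^ (q + j)) sums (z * deriv g z)"
proof -
  let ?c = "\<lambda>k. if k < q then 0 else c (k - q)"
  have "(\<lambda>k. ?c k * t ^ k) sums g t" if "t \<in> ball 0 1" for t
    using c[OF that] by (simp only: shifted_powser_sums_iff)
  note * = powser_deriv_sums[OF this z]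
  show "(g has_field_derivative deriv g z) (at z)" by (rule *(1))
  have "of_nat k * ?c k * z ^ k = (if k < q then 0 else of_nat (q + (k - q)) * c (k - q)) * z ^ k" for k
    by auto
  with *(2) show "(\<lambda>j. of_nat (q + j) * c j * z ^ (q + j)) sums (z * deriv g z)"
    by (simp only: shifted_powser_sums_iff[where c = "\<lambda>j. of_nat (q + j) * c j"])
qed

lemma shifted_powser_fps_expansion:
  fixes c :: "nat \<Rightarrow> complex"
  assumes c: "\<And>t. t \<in> ball 0 1 \<Longrightarrow> (\<lambda>j. c j * t ^ (q + j)) sums f t"
  shows "fps_nth (fps_expansion f 0) (q + j) = c j"
proof -
  define F where "F = Abs_fps (\<lambda>k. if k < q then 0 else c (k - q))"
  have "eventually (\<lambda>u::complex. u \<in> ball 0 1) (nhds 0)"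
    by (intro eventually_nhds_in_open) auto
  then have "eventually (\<lambda>u. (\<lambda>k. fps_nth F k * u ^ k) sums f u) (nhds 0)"
    by eventually_elim (use c shifted_powser_sums_iff[of q c] in \<open>simp add: F_def\<close>)
  then have "fps_expansion f 0 = F"
    by (intro fps_expansion_eqI has_fps_expansionI)
  then show ?thesis by (simp add: F_def)
qed

text \<open>
  Multiplying the coefficients by \<open>j + 1\<close> amounts to differentiating, which preserves convergence on
  the disc; iterating this absorbs any polynomially bounded factor.
\<close>
lemma summable_poly_mult:
  fixes c :: "nat \<Rightarrow> complex" and \<phi> :: "nat \<Rightarrow> real"
  assumes c: "\<And>t. t \<in> ball 0 1 \<Longrightarrow> summable (\<lambda>j. c j * t ^ j)"
    and \<phi>: "\<And>j. \<bar>\<phi> j\<bar> \<le> C * (real j + 1) ^ N" and z: "z \<in> ball 0 1"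
  shows "summable (\<lambda>j. of_real (\<phi> j) * c j * z ^ j)"
proof -
  have *: "summable (\<lambda>j. (of_nat j + 1) ^ N * c j * t ^ j)" if "t \<in> ball 0 1" for t
    using that
  proof (induction N arbitrary: t)
    case 0
    then show ?case using c by simp
  next
    case (Suc N)
    let ?c = "\<lambda>j. (of_nat j + 1) ^ N * c j"
    have "(\<lambda>j. ?c j * t ^ j) sums (\<Sum>j. ?c j * t ^ j)" if "t \<in> ball 0 1" for t
      using Suc.IH[OF that] by (rule summable_sums)
    from powser_deriv_sums(2)[OF this Suc.prems]
    have "summable (\<lambda>j. of_nat j * ?c j * t ^ j)" by (rule sums_summable)
    from summable_add[OF this Suc.IH[OF Suc.prems]] show ?case
      by (simp add: algebra_simps)
  qed
  have n: "norm ((of_nat j + 1 :: complex) ^ N) = (real j + 1) ^ N" for j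
  proof -
    have "(of_nat j + 1 :: complex) = of_nat (Suc j)" by simp
    then show ?thesis by (simp only: norm_power norm_of_nat) (simp add: add.commute)
  qed
  have "summable (\<lambda>j. C * norm ((of_nat j + 1) ^ N * c j * z ^ j))"
    by (intro summable_mult sums_imp_norm_summable_on_ball * z)
  then show ?thesis
  proof (rule summable_comparison_test')
    show "norm (of_real (\<phi> j) * c j * z ^ j) \<le> C * norm ((of_nat j + 1) ^ N * c j * z ^ j)" if "j \<ge> 0" for j
      using mult_right_mono[OF \<phi>[of j], of "norm (c j * z ^ j)"] by (simp add: norm_mult n mult_ac)
  qed
qed

section \<open>The coefficient bound\<close>

lemma Phi_mono:
  assumes "p \<ge> 1" "\<mu> \<ge> 0" "lam \<ge> \<mu>" "l \<ge> 0" "\<delta> \<ge> 0" "p \<le> i" "i \<le> k"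
  shows "Phi p i \<delta> lam \<mu> l \<le> Phi p k \<delta> lam \<mu> l"
proof -
  have "(real i - real p) * (lam * \<mu> * real i + lam - \<mu>) \<le> (real k - real p) * (lam * \<mu> * real k + lam - \<mu>)"
    using assms by (intro mult_mono) (auto intro!: mult_left_mono add_mono simp: add_diff_eq[symmetric])
  moreover have "(real i - real p) * (lam * \<mu> * real i + lam - \<mu>) \<ge> 0"
    using assms by (simp add: add_diff_eq[symmetric])
  ultimately show ?thesis
    using assms unfolding Phi_def by (intro powr_mono2 divide_right_mono) auto
qed

lemma Phi_ge_1:
  assumes "p \<ge> 1" "\<mu> \<ge> 0" "lam \<ge> \<mu>" "l \<ge> 0" "\<delta> \<ge> 0" "p \<le> k"
  shows "Phi p k \<delta> lam \<mu> l \<ge> 1"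
  using Phi_mono[OF assms(1-5) order.refl assms(6)] assms by (simp add: Phi_def)

text \<open>
  Polynomial growth is what makes the series of \<open>J_op\<close> converge on the whole disc. The base of the power at
  index \<open>n + p + j\<close> is at most \<open>(j + 1)\<^sup>2\<close> times its value at \<open>j = 0\<close>, since this
  step multiplies each of its two linear factors by at most \<open>j + 1\<close>.
\<close>
lemma Phi_growth:
  assumes "n \<ge> 1" "p \<ge> 1" "\<mu> \<ge> 0" "lam \<ge> \<mu>" "l \<ge> 0" "\<delta> \<ge> 0"
  shows "\<bar>Phi p (n + p + j) \<delta> lam \<mu> l\<bar> \<le> Phi p (n + p) \<delta> lam \<mu> l * (real j + 1) ^ (2 * nat \<lceil>\<delta>\<rceil>)"
proof -
  define b where "b = (\<lambda>k. ((real k - real p) * (lam * \<mu> * real k + lam - \<mu>) + real p + l) / (real p + l))"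
  have pl: "real p + l > 0" using assms by simp
  have nonneg: "lam * \<mu> \<ge> 0" using assms by simp
  have "real n + real j \<le> real n * (real j + 1)"
    using assms mult_mono[of 1 "real n" "real j" "real j"] by (simp add: algebra_simps)
  moreover have "lam * \<mu> * (real n + real p + real j) + (lam - \<mu>) \<le>
      (lam * \<mu> * (real n + real p) + (lam - \<mu>)) * (real j + 1)"
  proof -
    have "real n + real p + real j \<le> (real n + real p) * (real j + 1)"
      using assms mult_mono[of 1 "real n + real p" "real j" "real j"] by (simp add: algebra_simps)
    moreover have "lam - \<mu> \<le> (lam - \<mu>) * (real j + 1)"
      using assms by (simp add: mult_le_cancel_left1)
    ultimately show ?thesis
      using mult_left_mono[OF _ nonneg, of "real n + real p + real j" "(real n + real p) * (real j + 1)"]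
      by (simp add: algebra_simps)
  qed
  ultimately have "(real n + real j) * (lam * \<mu> * (real n + real p + real j) + (lam - \<mu>)) \<le>
      (real n * (real j + 1)) * ((lam * \<mu> * (real n + real p) + (lam - \<mu>)) * (real j + 1))"
    using assms nonneg by (intro mult_mono) auto
  moreover have "real p + l \<le> (real p + l) * (real j + 1)\<^sup>2"
    using pl by (simp add: mult_le_cancel_left1)
  ultimately have "b (n + p + j) \<le> b (n + p) * (real j + 1)\<^sup>2"
    using pl by (simp add: b_def divide_right_mono power2_eq_square algebra_simps flip: add_divide_distrib)
  moreover have "b (n + p + j) \<ge> 0"
    using assms nonneg by (simp add: b_def add_diff_eq[symmetric])
  moreover have b0: "b (n + p) \<ge> 0"
    using assms nonneg by (simp add: b_def add_diff_eq[symmetric])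
  ultimately have "b (n + p + j) powr \<delta> \<le> (b (n + p) * (real j + 1)\<^sup>2) powr \<delta>"
    using assms by (intro powr_mono2) auto
  also have "\<dots> = b (n + p) powr \<delta> * ((real j + 1)\<^sup>2) powr \<delta>"
    using b0 by (simp add: powr_mult)
  also have "\<dots> \<le> b (n + p) powr \<delta> * ((real j + 1)\<^sup>2) powr real (nat \<lceil>\<delta>\<rceil>)"
    by (intro mult_left_mono powr_mono) (auto simp: real_nat_ceiling_ge)
  also have "((real j + 1)\<^sup>2) powr real (nat \<lceil>\<delta>\<rceil>) = (real j + 1) ^ (2 * nat \<lceil>\<delta>\<rceil>)"
    by (subst powr_realpow) (auto simp: power_mult)
  finally show ?thesis by (simp add: b_def Phi_def)
qed

text \<open>
  The factor \<open>k \<Phi>\<^sub>k\<close>, \<open>k = n + p + j\<close>, by which \<open>f \<mapsto> (J f)' / z ^ (p - 1)\<close> multiplies the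
  coefficient of \<open>z ^ k\<close>.
\<close>
definition J_coeff :: "nat \<Rightarrow> nat \<Rightarrow> real \<Rightarrow> real \<Rightarrow> real \<Rightarrow> real \<Rightarrow> nat \<Rightarrow> real" where
  "J_coeff n p \<delta> lam \<mu> l j = real (n + p + j) * Phi p (n + p + j) \<delta> lam \<mu> l"

text \<open>
  Termwise differentiation gives \<open>z (J f)'(z) = z ^ p (p - S z)\<close>; cancelling \<open>z ^ p\<close> away from the
  origin leaves \<open>p - S z\<close>, which is holomorphic at the origin too and hence is the removed singularity.
\<close>
lemma remove_sings_deriv_J_op:
  assumes params: "n \<ge> 1" "p \<ge> 1" "\<mu> \<ge> 0" "lam \<ge> \<mu>" "l \<ge> 0" "\<delta> \<ge> 0"
    and f: "\<And>t. t \<in> ball 0 1 \<Longrightarrow> (\<lambda>j. of_real (m j) * t ^ (n + p + j)) sums (t ^ p - f t)"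
    and S: "S = (\<lambda>t. \<Sum>j. of_real (J_coeff n p \<delta> lam \<mu> l j * m j) * t ^ (n + j))"
    and z: "z \<in> ball 0 1"
  shows "(\<lambda>j. of_real (J_coeff n p \<delta> lam \<mu> l j * m j) * z ^ (n + j)) sums S z"
    and "S holomorphic_on ball 0 1"
    and "remove_sings (\<lambda>u. deriv (J_op n p \<delta> lam \<mu> l f) u / u ^ (p - 1)) z = of_nat p - S z"
proof -
  define \<Phi> where "\<Phi> = (\<lambda>j. Phi p (n + p + j) \<delta> lam \<mu> l)"
  have "(\<lambda>j. of_real (m j) * t ^ (p + (n + j))) sums (t ^ p - f t)" if "t \<in> ball 0 1" for t
    using f[OF that] by (simp add: add_ac)
  then have f': "(\<lambda>j. gap_coeff n m j * t ^ (p + j)) sums f t" if "t \<in> ball 0 1" for t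
    using gap_sums_iff[OF params(1), of m "\<lambda>j. t ^ (p + j)" "t ^ p - f t"] that by simp
  have nth: "fps_nth (fps_expansion f 0) (n + p + j) = - of_real (m j)" for j
    using shifted_powser_fps_expansion[OF f', of "n + j"] params by (simp add: gap_coeff_def add_ac)
  have msum: "summable (\<lambda>j. of_real (m j) * t ^ j)" if "t \<in> ball 0 1" for t :: complex
    by (cases "t = 0") (use power_factor_sums(2)[OF f[OF that]] in auto)
  have \<Phi>sum: "summable (\<lambda>j. of_real (\<Phi> j) * of_real (m j) * t ^ j)" if "t \<in> ball 0 1" for t :: complex
    unfolding \<Phi>_def by (rule summable_poly_mult[OF msum Phi_growth[OF params] that])
  define J where "J = J_op n p \<delta> lam \<mu> l f"
  have J: "(\<lambda>j. gap_coeff n (\<lambda>j. \<Phi> j * m j) j * t ^ (p + j)) sums J t" if t: "t \<in> ball 0 1" for t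
  proof -
    have "summable (\<lambda>j. t ^ (n + p) * (of_real (\<Phi> j) * of_real (m j) * t ^ j))"
      by (intro summable_mult \<Phi>sum t)
    then have sm: "summable (\<lambda>j. of_real (\<Phi> j * m j) * t ^ (p + (n + j)))"
      by (simp add: power_add mult_ac)
    have "J t = t ^ p - (\<Sum>j. of_real (\<Phi> j * m j) * t ^ (p + (n + j)))"
      unfolding J_def J_op_def nth using suminf_minus[OF sm] by (simp add: \<Phi>_def add_ac mult_ac)
    with summable_sums[OF sm] show ?thesis
      using gap_sums_iff[OF params(1), of "\<lambda>j. \<Phi> j * m j" "\<lambda>j. t ^ (p + j)" "\<Sum>j. of_real (\<Phi> j * m j) * t ^ (p + (n + j))"]
      by simp
  qed
  have zJ: "(\<lambda>j. of_real (J_coeff n p \<delta> lam \<mu> l j * m j) * t ^ (p + (n + j))) sums (of_nat p * t ^ p - t * deriv J t)"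
    if t: "t \<in> ball 0 1" for t
  proof -
    have "(\<lambda>j. gap_coeff n (\<lambda>j. \<Phi> j * m j) j * (of_nat (p + j) * t ^ (p + j))) sums (t * deriv J t)"
      using shifted_powser_deriv_sums(2)[OF J t] by (simp add: mult_ac)
    then have "(\<lambda>j. of_real (\<Phi> j * m j) * (of_nat (p + (n + j)) * t ^ (p + (n + j)))) sums (of_nat p * t ^ p - t * deriv J t)"
      using gap_sums_iff[OF params(1), of "\<lambda>j. \<Phi> j * m j" "\<lambda>j. of_nat (p + j) * t ^ (p + j)" "of_nat p * t ^ p - t * deriv J t"]
      by simp
    moreover have "of_real (\<Phi> j * m j) * (of_nat (p + (n + j)) * t ^ (p + (n + j))) =
        of_real (J_coeff n p \<delta> lam \<mu> l j * m j) * t ^ (p + (n + j))" for j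
      by (simp add: J_coeff_def \<Phi>_def algebra_simps)
    ultimately show ?thesis by (simp only:)
  qed
  have sm: "(\<lambda>j. of_real (J_coeff n p \<delta> lam \<mu> l j * m j) * t ^ (n + j)) sums S t" if t: "t \<in> ball 0 1" for t
  proof (cases "t = 0")
    case True
    then show ?thesis using params by (auto simp: S power_0_left)
  next
    case False
    have "summable (\<lambda>j. of_real (J_coeff n p \<delta> lam \<mu> l j * m j) * t ^ n * t ^ j)"
      by (rule power_factor_sums(2)[where q = p]) (use zJ[OF t] False in \<open>auto simp: power_add mult_ac\<close>)
    then show ?thesis by (simp add: S power_add mult_ac summable_sums)
  qed
  show "(\<lambda>j. of_real (J_coeff n p \<delta> lam \<mu> l j * m j) * z ^ (n + j)) sums S z"
    by (rule sm[OF z])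
  show hol: "S holomorphic_on ball 0 1"
    using shifted_powser_deriv_sums(1)[OF sm] by (fastforce simp: holomorphic_on_open)
  have quot: "deriv J u / u ^ (p - 1) = of_nat p - S u" if u: "u \<in> ball 0 1" "u \<noteq> 0" for u
  proof -
    have "(\<lambda>j. u ^ p * (of_real (J_coeff n p \<delta> lam \<mu> l j * m j) * u ^ (n + j))) sums (u ^ p * S u)"
      by (intro sums_mult sm u)
    then have "u ^ p * S u = of_nat p * u ^ p - u * deriv J u"
      using zJ[OF u(1)] by (intro sums_unique2) (auto simp: power_add mult_ac)
    moreover have "u ^ p = u * u ^ (p - 1)" using params by (cases p) auto
    ultimately have "u * (u ^ (p - 1) * S u) = u * (of_nat p * u ^ (p - 1) - deriv J u)"
      by (simp add: algebra_simps)
    then have "u ^ (p - 1) * S u = of_nat p * u ^ (p - 1) - deriv J u"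
      using u by simp
    then show ?thesis using u by (simp add: field_simps)
  qed
  have "eventually (\<lambda>u. u \<in> ball 0 1 - {z}) (at z)"
    using z by (intro eventually_at_in_open) auto
  moreover have "eventually (\<lambda>u. u \<noteq> 0) (at z)"
    by (rule eventually_neq_at_within)
  ultimately have "eventually (\<lambda>u. u \<in> ball 0 1 - {0}) (at z)"
    by eventually_elim auto
  then have "eventually (\<lambda>u. of_nat p - S u = deriv J u / u ^ (p - 1)) (at z)"
    by eventually_elim (rule quot[symmetric], auto)
  moreover have "isCont S z"
    using hol z by (meson holomorphic_on_imp_continuous_on continuous_on_interior interior_open open_ball continuous_on_eq_continuous_at)
  then have "((\<lambda>u. of_nat p - S u) \<longlongrightarrow> of_nat p - S z) (at z)"
    by (intro tendsto_intros) (simp add: isContD)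
  ultimately show "remove_sings (\<lambda>u. deriv (J_op n p \<delta> lam \<mu> l f) u / u ^ (p - 1)) z = of_nat p - S z"
    unfolding J_def by (intro remove_sings_eqI) (rule Lim_transform_eventually)
qed

lemma subordinate_cong:
  assumes "\<And>z. z \<in> ball 0 1 \<Longrightarrow> F z = F' z"
  shows "subordinate F G \<longleftrightarrow> subordinate F' G"
proof -
  have "F holomorphic_on ball 0 1 \<longleftrightarrow> F' holomorphic_on ball 0 1"
    by (rule holomorphic_cong) (use assms in auto)
  then show ?thesis
    using assms by (simp add: subordinate_def)
qed

text \<open>
  If \<open>h = (B - A) / (1 + B)\<close> at some point, solving \<open>1 - h = (1 + A w) / (1 + B w)\<close> gives
  \<open>w = 1\<close>, contrary to \<open>\<bar>w\<bar> < 1\<close>. A function that is real on the radius \<open>[0, 1)\<close> and starts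
  from \<open>0\<close> therefore cannot reach this value, by the intermediate value theorem.
\<close>
lemma subordinate_real_axis_bound:
  fixes h :: "complex \<Rightarrow> complex" and \<eta> :: "real \<Rightarrow> real"
  assumes AB: "- 1 \<le> A" "A < B" "B \<le> 1" "0 < B"
    and sub: "subordinate (\<lambda>z. 1 - h z) (\<lambda>z. (1 + of_real A * z) / (1 + of_real B * z))"
    and real: "\<And>r. 0 \<le> r \<Longrightarrow> r < 1 \<Longrightarrow> h (of_real r) = of_real (\<eta> r)"
    and "\<eta> 0 = 0" "0 \<le> r" "r < 1"
  shows "\<eta> r < (B - A) / (1 + B)"
proof (rule ccontr)
  assume "\<not> \<eta> r < (B - A) / (1 + B)"
  then have ge: "(B - A) / (1 + B) \<le> \<eta> r" by simp
  from sub obtain w where w: "\<And>z. z \<in> ball 0 1 \<Longrightarrow> norm (w z) < 1"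
      "\<And>z. z \<in> ball 0 1 \<Longrightarrow> 1 - h z = (1 + of_real A * w z) / (1 + of_real B * w z)"
    and hol: "(\<lambda>z. 1 - h z) holomorphic_on ball 0 1"
    unfolding subordinate_def by blast
  have "continuous_on (ball 0 1) (\<lambda>z. 1 - h z)"
    using hol by (rule holomorphic_on_imp_continuous_on)
  then have "continuous_on {0..r} (\<lambda>x. 1 - h (of_real x))"
    by (rule continuous_on_compose2) (use assms in \<open>auto intro!: continuous_intros\<close>)
  from continuous_on_diff[OF continuous_on_const continuous_on_Re[OF this]]
  have "continuous_on {0..r} (\<lambda>x. 1 - Re (1 - h (of_real x)))" .
  moreover have "1 - Re (1 - h (of_real x)) = \<eta> x" if "x \<in> {0..r}" for x
    using real[of x] that assms by simp
  ultimately have "continuous_on {0..r} \<eta>"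
    by (subst (asm) continuous_on_cong[OF refl]) auto
  then obtain x where x: "0 \<le> x" "x \<le> r" "\<eta> x = (B - A) / (1 + B)"
    using IVT'[of \<eta> 0 "(B - A) / (1 + B)" r] ge assms by auto
  define v where "v = w (of_real x)"
  have xb: "complex_of_real x \<in> ball 0 1" using x assms by simp
  have v: "norm v < 1" using w(1)[OF xb] by (simp add: v_def)
  have "norm (of_real B * v) < 1"
    using v AB mult_mono[of B 1 "norm v" "norm v"] by (simp add: norm_mult)
  then have "1 + of_real B * v \<noteq> 0"
    by (metis add_eq_0_iff norm_minus_cancel norm_one less_irrefl)
  moreover have "1 - of_real ((B - A) / (1 + B)) = (1 + of_real A * v) / (1 + of_real B * v)"
    using w(2)[OF xb] real[of x] x assms by (simp add: v_def)
  ultimately have "(1 - of_real ((B - A) / (1 + B))) * (1 + of_real B * v) = 1 + of_real A * v"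
    by simp
  moreover have "complex_of_real (1 + B) \<noteq> 0"
    using AB by (metis add_pos_pos of_real_eq_0_iff zero_less_one less_irrefl)
  ultimately have "complex_of_real (B - A) * (1 - v) = 0"
    by (simp add: field_simps)
  then have "v = 1" using AB by (simp flip: of_real_diff)
  then show False using v by simp
qed

text \<open>
  On the radius \<open>[0, 1)\<close> the partial sums stay below the bounded sum because all terms are nonnegative;
  being polynomials, they inherit the bound at \<open>1\<close>, where the series itself is not known to converge.
\<close>
lemma class_P_tilde_coeff_bound:
  assumes params: "n \<ge> 1" "p \<ge> 1" "\<mu> \<ge> 0" "lam \<ge> \<mu>" "l \<ge> 0" "\<delta> \<ge> 0"
    and AB: "- 1 \<le> A" "A < B" "B \<le> 1" "0 < B" and \<sigma>: "\<sigma> < real p"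
    and f: "f \<in> class_P_tilde n p \<delta> lam \<mu> l A B \<sigma>"
  obtains m where "\<And>j. m j \<ge> 0"
    "\<And>t. t \<in> ball 0 1 \<Longrightarrow> (\<lambda>j. of_real (m j) * t ^ (n + p + j)) sums (t ^ p - f t)"
    "summable (\<lambda>j. J_coeff n p \<delta> lam \<mu> l j * m j)"
    "(\<Sum>j. J_coeff n p \<delta> lam \<mu> l j * m j) \<le> (B - A) * (real p - \<sigma>) / (1 + B)"
proof -
  from f obtain a where a: "\<And>t. t \<in> ball 0 1 \<Longrightarrow>
       (\<lambda>j. complex_of_real (norm (a (n + p + j) :: complex)) * t ^ (n + p + j)) sums (t ^ p - f t)"
    unfolding class_P_tilde_def by blast
  define m where "m = (\<lambda>j. norm (a (n + p + j)))"
  have m: "(\<lambda>j. of_real (m j) * t ^ (n + p + j)) sums (t ^ p - f t)" if "t \<in> ball 0 1" for t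
    using a[OF that] by (simp add: m_def)
  have m0: "m j \<ge> 0" for j by (simp add: m_def)
  define s where "s = (\<lambda>j. J_coeff n p \<delta> lam \<mu> l j * m j)"
  have s0: "s j \<ge> 0" for j by (simp add: s_def J_coeff_def Phi_def m0)
  define S :: "complex \<Rightarrow> complex" where "S = (\<lambda>t. \<Sum>j. of_real (s j) * t ^ (n + j))"
  have J: "(\<lambda>j. of_real (s j) * z ^ (n + j)) sums S z"
    "remove_sings (\<lambda>u. deriv (J_op n p \<delta> lam \<mu> l f) u / u ^ (p - 1)) z = of_nat p - S z"
    if "z \<in> ball 0 1" for z
    unfolding s_def
    by (rule remove_sings_deriv_J_op[OF params m S_def[unfolded s_def] that]; assumption)+
  define K where "K = (B - A) * (real p - \<sigma>) / (1 + B)"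
  let ?G = "\<lambda>z. (1 + of_real A * z) / (1 + complex_of_real B * z)"
  have P: "subordinate (\<lambda>z. 1 / of_real (real p - \<sigma>) *
          (remove_sings (\<lambda>u. deriv (J_op n p \<delta> lam \<mu> l f) u / u ^ (p - 1)) z - of_real \<sigma>)) ?G"
    using f by (simp add: class_P_tilde_def class_P_def)
  have F: "1 / of_real (real p - \<sigma>) *
          (remove_sings (\<lambda>u. deriv (J_op n p \<delta> lam \<mu> l f) u / u ^ (p - 1)) z - of_real \<sigma>) = 1 - S z / of_real (real p - \<sigma>)"
    if "z \<in> ball 0 1" for z
  proof -
    have "complex_of_real (real p - \<sigma>) \<noteq> 0" using \<sigma> by (simp flip: of_real_diff)
    moreover have "of_nat p - S z - of_real \<sigma> = complex_of_real (real p - \<sigma>) - S z" by simp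
    ultimately show ?thesis
      unfolding J(2)[OF that] by (simp only:) (simp add: diff_divide_distrib)
  qed
  have sub: "subordinate (\<lambda>z. 1 - S z / of_real (real p - \<sigma>)) ?G"
    by (rule subordinate_cong[THEN iffD1, OF F P])
  have partial: "(\<Sum>j<N. s j) \<le> K" for N
  proof (rule tendsto_upperbound)
    show "((\<lambda>r. \<Sum>j<N. s j * r ^ (n + j)) \<longlongrightarrow> (\<Sum>j<N. s j)) (at_left 1)"
      by (auto intro!: tendsto_eq_intros)
    have "eventually (\<lambda>r::real. r \<in> {0<..<1}) (at_left 1)"
      by (rule eventually_at_leftI[of 0]) auto
    then show "eventually (\<lambda>r. (\<Sum>j<N. s j * r ^ (n + j)) \<le> K) (at_left 1)"
    proof eventually_elim
      case (elim r)
      have real: "summable (\<lambda>j. s j * r ^ (n + j)) \<and> S (of_real r) = of_real (\<Sum>j. s j * r ^ (n + j))" if "0 \<le> r" "r < 1" for r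
      proof -
        have "(\<lambda>j. complex_of_real (s j * r ^ (n + j))) sums S (of_real r)"
          using J(1)[of "of_real r"] that by simp
        from sums_Re[OF this] have Re: "(\<lambda>j. s j * r ^ (n + j)) sums Re (S (of_real r))"
          by simp
        have "S (of_real r) = of_real (Re (S (of_real r)))"
          by (rule sums_unique2[OF _ sums_of_real[OF Re]]) fact
        with Re show ?thesis
          by (simp add: sums_iff)
      qed
      have "(\<Sum>j. s j * r ^ (n + j)) / (real p - \<sigma>) < (B - A) / (1 + B)"
      proof (rule subordinate_real_axis_bound[OF AB sub, where r = r and
          \<eta> = "\<lambda>x. (\<Sum>j. s j * x ^ (n + j)) / (real p - \<sigma>)"])
        show "S (of_real x) / of_real (real p - \<sigma>) = of_real ((\<Sum>j. s j * x ^ (n + j)) / (real p - \<sigma>))"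
          if "0 \<le> x" "x < 1" for x
          using real[OF that] by simp
      qed (use elim params in \<open>auto simp: power_0_left\<close>)
      then have "(\<Sum>j. s j * r ^ (n + j)) \<le> K"
        using \<sigma> by (simp add: K_def pos_divide_less_eq less_imp_le)
      moreover have "(\<Sum>j<N. s j * r ^ (n + j)) \<le> (\<Sum>j. s j * r ^ (n + j))"
        by (rule sum_le_suminf) (use real[of r] elim s0 in auto)
      ultimately show ?case by simp
    qed
  qed auto
  have sm: "summable s"
    by (rule summableI_nonneg_bounded[OF s0 partial])
  show ?thesis
  proof (rule that[of m])
    show "summable (\<lambda>j. J_coeff n p \<delta> lam \<mu> l j * m j)" using sm by (simp add: s_def)
    show "(\<Sum>j. J_coeff n p \<delta> lam \<mu> l j * m j) \<le> (B - A) * (real p - \<sigma>) / (1 + B)"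
      using suminf_le_const[OF sm partial] by (simp add: s_def K_def)
  qed (use m0 m in auto)
qed

section \<open>The extremal trinomial\<close>

text \<open>
  The Noshiro--Warschawski criterion. Along the segment from \<open>a\<close> to \<open>b\<close>, the real part of
  \<open>G / (b - a)\<close> has derivative \<open>Re G' > 0\<close>, so it takes different values at the end points.
\<close>
lemma Re_deriv_pos_imp_inj_on:
  assumes "convex S" and G: "\<And>z. z \<in> S \<Longrightarrow> (G has_field_derivative G' z) (at z)"
    and pos: "\<And>z. z \<in> S \<Longrightarrow> Re (G' z) > 0"
  shows "inj_on G S"
proof (rule inj_onI, rule ccontr)
  fix a b assume ab: "a \<in> S" "b \<in> S" "G a = G b" "a \<noteq> b"
  let ?\<gamma> = "\<lambda>t::real. a + of_real t * (b - a)"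
  have in_S: "?\<gamma> t \<in> S" if "0 \<le> t" "t \<le> 1" for t
    using convexD_alt[OF \<open>convex S\<close> ab(1,2) that] by (simp add: scaleR_conv_of_real algebra_simps)
  have "Re (G (?\<gamma> 0) / (b - a)) < Re (G (?\<gamma> 1) / (b - a))"
  proof (rule DERIV_pos_imp_increasing[of 0 1 "\<lambda>t. Re (G (?\<gamma> t) / (b - a))"])
    fix t :: real assume t: "0 \<le> t" "t \<le> 1"
    have "(?\<gamma> has_vector_derivative (b - a)) (at t)"
      by (auto intro!: derivative_eq_intros)
    from field_vector_diff_chain_at[OF this G[OF in_S[OF t]]]
    have "((\<lambda>t. G (?\<gamma> t)) has_vector_derivative (b - a) * G' (?\<gamma> t)) (at t)"
      by (simp add: o_def)
    from has_vector_derivative_mult_left[OF this, of "1 / (b - a)"] ab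
    have "((\<lambda>t. G (?\<gamma> t) / (b - a)) has_vector_derivative G' (?\<gamma> t)) (at t)"
      by simp
    then have "((\<lambda>t. Re (G (?\<gamma> t) / (b - a))) has_vector_derivative Re (G' (?\<gamma> t))) (at t)"
      by (rule bounded_linear.has_vector_derivative[OF bounded_linear_Re])
    then show "\<exists>y. ((\<lambda>t. Re (G (?\<gamma> t) / (b - a))) has_real_derivative y) (at t) \<and> 0 < y"
      using pos[OF in_S[OF t]] by (auto simp: has_real_derivative_iff_has_vector_derivative)
  qed simp
  then show False using ab by simp
qed

lemma norm_mult_power_less:
  fixes z :: complex
  assumes "n \<ge> 1" "c > 0" "z \<in> ball 0 1"
  shows "norm (of_real c * z ^ n) < c"
proof -
  have "norm z ^ n \<le> norm z ^ 1" by (rule power_decreasing) (use assms in auto)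
  then show ?thesis using assms by (simp add: norm_mult norm_power)
qed

lemma trinomial_coeff_less_1:
  assumes "n \<ge> 1" "c > 0" "c * real (n + p) \<le> real p"
  shows "c < 1"
proof (rule ccontr)
  assume "\<not> c < 1"
  then have "1 * real (n + p) \<le> c * real (n + p)" by (intro mult_right_mono) auto
  also have "\<dots> \<le> real p" by (rule assms(3))
  finally show False using assms(1) by simp
qed

text \<open>
  The function \<open>z (1 - c z ^ n) ^ (1 / p)\<close> is the exponential of
  \<open>G(s) = s + Ln (1 - c exp(s) ^ n) / p\<close> at \<open>s = Ln z\<close>. With \<open>u = c z ^ n\<close> one has
  \<open>G'(s) = 1 - n u / (p (1 - u))\<close>, and on the disc \<open>\<bar>u\<bar> < c \<le> p / (n + p)\<close> is exactly what keeps the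
  subtracted term below \<open>1\<close> in modulus. Since \<open>G\<close> commutes with translation by \<open>2 \<pi> \<i>\<close>,
  injectivity of \<open>G\<close> on the half-plane descends to the disc.
\<close>
lemma trinomial_root_inj_on:
  assumes n: "n \<ge> 1" and p: "p \<ge> 1" and c: "c > 0" "c * real (n + p) \<le> real p"
  shows "inj_on (\<lambda>z::complex. z * exp (Ln (1 - of_real c * z ^ n) / of_nat p)) (ball 0 1)"
proof -
  define G where "G = (\<lambda>s. s + Ln (1 - of_real c * exp s ^ n) / of_nat p)"
  define H where "H = {s::complex. Re s < 0}"
  have "inj_on G H"
  proof (rule Re_deriv_pos_imp_inj_on)
    show "convex H" unfolding H_def by (rule convex_halfspace_Re_lt)
    fix s assume "s \<in> H"
    then have es: "exp s \<in> ball 0 1" by (simp add: H_def)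
    define u where "u = of_real c * exp s ^ n"
    have u: "norm u < c" unfolding u_def by (rule norm_mult_power_less[OF n c(1) es])
    have c1: "c < 1"
      by (rule trinomial_coeff_less_1[OF n c])
    have "Re u < 1" using u c1 complex_Re_le_cmod[of u] by linarith
    then have nonpos: "1 - u \<notin> \<real>\<^sub>\<le>\<^sub>0"
      by (auto simp: complex_nonpos_Reals_iff)
    show "(G has_field_derivative 1 - of_nat n * u / (of_nat p * (1 - u))) (at s)"
    proof -
      have "exp s * exp s ^ (n - 1) = exp s ^ n" using n by (cases n) auto
      moreover have "1 - of_real c * exp s ^ n \<noteq> 0" using nonpos by (auto simp: u_def)
      ultimately show ?thesis
        unfolding G_def using nonpos p
        by (auto intro!: derivative_eq_intros simp: u_def field_simps)
    qed
    have "real n * norm u < real p * (1 - norm u)"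
      using u c mult_strict_right_mono[OF u, of "real (n + p)"] n by (simp add: algebra_simps)
    also have "\<dots> \<le> real p * norm (1 - u)"
      using norm_triangle_ineq2[of 1 u] by (intro mult_left_mono) auto
    finally have lt: "real n * norm u < real p * norm (1 - u)" .
    have "norm (of_nat n * u / (of_nat p * (1 - u))) < 1"
    proof -
      have "real p * norm (1 - u) > 0" using lt by (rule le_less_trans[rotated]) auto
      then show ?thesis using lt by (simp add: norm_divide norm_mult pos_divide_less_eq)
    qed
    then show "Re (1 - of_nat n * u / (of_nat p * (1 - u))) > 0"
      using complex_Re_le_cmod[of "of_nat n * u / (of_nat p * (1 - u))"] by simp
  qed
  note inj = this
  show ?thesis
  proof (rule inj_onI)
    fix x y :: complex
    assume xy: "x \<in> ball 0 1" "y \<in> ball 0 1" and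
      eq: "x * exp (Ln (1 - of_real c * x ^ n) / of_nat p) = y * exp (Ln (1 - of_real c * y ^ n) / of_nat p)"
    show "x = y"
    proof (cases "x = 0 \<or> y = 0")
      case True
      then show ?thesis using eq by auto
    next
      case False
      have e: "x * exp (Ln (1 - of_real c * x ^ n) / of_nat p) = exp (G (Ln x))" if "x \<noteq> 0" for x
        using that by (simp add: G_def exp_add)
      have "exp (G (Ln x)) = exp (G (Ln y))" using eq e False by simp
      then obtain k :: int where k: "G (Ln x) = G (Ln y) + (of_int (2 * k) * pi) * \<i>"
        by (auto simp: exp_eq)
      \<comment> \<open>Move to another logarithm of \<open>y\<close>, at which \<open>G\<close> agrees with its value at \<open>Ln x\<close> exactly.\<close>
      define s where "s = Ln y + (of_int (2 * k) * pi) * \<i>"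
      have es: "exp s = exp (Ln y)" unfolding s_def exp_eq by blast
      have "G s = G (Ln x)" unfolding k by (simp add: G_def es) (simp add: s_def)
      moreover have "s \<in> H" "Ln x \<in> H"
        using xy False by (auto simp: H_def s_def)
      ultimately have "s = Ln x" using inj by (auto dest: inj_onD)
      then show "x = y" using es False by simp
    qed
  qed
qed

text \<open>
  The value \<open>0\<close> is taken only at the origin, with multiplicity \<open>p\<close>. A value \<open>v \<noteq> 0\<close> is taken only at
  simple points, as the derivative \<open>z ^ (p - 1) (p - c (n + p) z ^ n)\<close> vanishes only at the origin,
  and the injective \<open>p\<close>-th root \<open>g\<close> maps these points into the \<open>p\<close> roots of \<open>\<zeta> ^ p = v\<close>.
\<close>
lemma trinomial_p_valent:
  assumes n: "n \<ge> 1" and p: "p \<ge> 1" and c: "c > 0" "c * real (n + p) \<le> real p"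
  shows "p_valent p (\<lambda>z. z ^ p - of_real c * z ^ (n + p)) (ball 0 1)"
proof -
  define f where "f = (\<lambda>z::complex. z ^ p - of_real c * z ^ (n + p))"
  define g where "g = (\<lambda>z::complex. z * exp (Ln (1 - of_real c * z ^ n) / of_nat p))"
  have c1: "c < 1"
    by (rule trinomial_coeff_less_1[OF n c])
  have f_eq: "f z = z ^ p * (1 - of_real c * z ^ n)" for z
    by (simp add: f_def algebra_simps power_add)
  have nz: "1 - of_real c * z ^ n \<noteq> 0" if "z \<in> ball 0 1" for z :: complex
    using norm_mult_power_less[OF n c(1) that] c1 by auto
  have g_pow: "g z ^ p = f z" if "z \<in> ball 0 1" for z
  proof -
    have "exp (Ln (1 - of_real c * z ^ n) / of_nat p) ^ p = exp (Ln (1 - of_real c * z ^ n))"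
      using p by (simp flip: exp_of_nat_mult)
    then show ?thesis using nz[OF that] by (simp add: g_def f_eq power_mult_distrib)
  qed
  have inj: "inj_on g (ball 0 1)"
    unfolding g_def by (rule trinomial_root_inj_on[OF assms])
  have count0: "{z \<in> ball 0 1. f z = 0} = {0}" "value_count f (ball 0 1) 0 = p"
  proof -
    show 0: "{z \<in> ball 0 1. f z = 0} = {0}" using nz p by (auto simp: f_eq)
    have "zorder (\<lambda>w. f w - 0) 0 = int p"
      by (rule zorder_eqI[of UNIV _ "\<lambda>z. 1 - of_real c * z ^ n"])
         (use n in \<open>auto intro!: holomorphic_intros simp: f_eq power_0_left\<close>)
    then show "value_count f (ball 0 1) 0 = p" unfolding value_count_def 0 by simp
  qed
  have count: "finite {z \<in> ball 0 1. f z = v} \<and> value_count f (ball 0 1) v \<le> p" if v: "v \<noteq> 0" for v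
  proof -
    have sub: "g ` {z \<in> ball 0 1. f z = v} \<subseteq> {\<zeta>. \<zeta> ^ p = v}" using g_pow by auto
    have card: "card {\<zeta>. \<zeta> ^ p = v} = p" using card_nth_roots[OF v] p by simp
    then have fin: "finite {\<zeta>. \<zeta> ^ p = v}" using p by (intro card_ge_0_finite) simp
    have inj': "inj_on g {z \<in> ball 0 1. f z = v}" by (rule inj_on_subset[OF inj]) auto
    have "card {z \<in> ball 0 1. f z = v} \<le> p"
      using card_inj_on_le[OF inj' sub fin] card by simp
    moreover have "zorder (\<lambda>w. f w - v) z = 1" if z: "z \<in> ball 0 1" "f z = v" for z
    proof (rule zorder_zero_eqI[of _ UNIV])
      have z0: "z \<noteq> 0" using v z p by (auto simp: f_eq)
      have D: "((\<lambda>w. f w - v) has_field_derivative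
          z ^ (p - 1) * (of_nat p - of_real (c * real (n + p)) * z ^ n)) (at z)"
      proof -
        have "z ^ (n + p - 1) = z ^ (p - 1) * z ^ n" using p by (cases p) (auto simp: power_add)
        then show ?thesis
          unfolding f_def by (auto intro!: derivative_eq_intros simp: algebra_simps)
      qed
      have "c * real (n + p) > 0" using n c by simp
      from norm_mult_power_less[OF n this z(1)] c(2)
      have "norm (of_real (c * real (n + p)) * z ^ n) < norm (of_nat p :: complex)" by simp
      then have "of_nat p - of_real (c * real (n + p)) * z ^ n \<noteq> 0" by auto
      then show "(deriv ^^ nat 1) (\<lambda>w. f w - v) z \<noteq> 0"
        using DERIV_imp_deriv[OF D] z0 by simp
      show "(\<lambda>w. f w - v) holomorphic_on UNIV"
        unfolding f_def by (intro holomorphic_intros)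
    qed (use z in auto)
    then have "value_count f (ball 0 1) v = card {z \<in> ball 0 1. f z = v}"
      by (simp add: value_count_def)
    moreover have "finite {z \<in> ball 0 1. f z = v}"
      by (rule inj_on_finite[OF inj' sub fin])
    ultimately show ?thesis by simp
  qed
  have "finite {z \<in> ball 0 1. f z = v} \<and> value_count f (ball 0 1) v \<le> p" for v
    using count[of v] count0 by (cases "v = 0") auto
  then show ?thesis
    using count0(2) unfolding p_valent_def f_def[symmetric] by blast
qed

text \<open>
  Here the function to be subordinated is \<open>1 - \<kappa> z ^ n\<close> with \<open>\<kappa> = (B - A) / (1 + B)\<close>, and solving
  for the subordinating function gives \<open>z ^ n / (1 + B - B z ^ n)\<close>, which is less than \<open>1\<close> in modulus
  because \<open>1 + B - B r > r\<close> for \<open>0 \<le> r < 1\<close>. The bound \<open>c (n + p) \<le> p\<close> needed for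
  \<open>p\<close>-valence follows from \<open>\<Phi> \<ge> 1\<close>, \<open>B - A \<le> 1 + B\<close> and \<open>\<sigma> \<ge> 0\<close>.
\<close>
lemma trinomial_in_class_P_tilde:
  assumes params: "n \<ge> 1" "p \<ge> 1" "\<mu> \<ge> 0" "lam \<ge> \<mu>" "l \<ge> 0" "\<delta> \<ge> 0"
    and AB: "- 1 \<le> A" "A < B" "B \<le> 1" "0 < B" and \<sigma>: "0 \<le> \<sigma>" "\<sigma> < real p"
    and c: "c * J_coeff n p \<delta> lam \<mu> l 0 = (B - A) * (real p - \<sigma>) / (1 + B)"
  shows "(\<lambda>z. z ^ p - of_real c * z ^ (n + p)) \<in> class_P_tilde n p \<delta> lam \<mu> l A B \<sigma>"
    (is "?f \<in> _")
proof -
  have ge: "J_coeff n p \<delta> lam \<mu> l 0 \<ge> real (n + p)"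
    using Phi_ge_1[OF params(2-6), of "n + p"] by (simp add: J_coeff_def mult_le_cancel_left1)
  have pos: "(B - A) * (real p - \<sigma>) / (1 + B) > 0"
    using AB \<sigma> by (intro divide_pos_pos mult_pos_pos) auto
  then have c0: "c > 0"
    using ge params unfolding c[symmetric] by (simp add: zero_less_mult_iff)
  have "c * real (n + p) \<le> (B - A) / (1 + B) * (real p - \<sigma>)"
    using mult_left_mono[OF ge, of c] c0 c by simp
  also have "\<dots> \<le> 1 * real p"
    using AB \<sigma> by (intro mult_mono) (auto simp: divide_simps)
  finally have cp: "c * real (n + p) \<le> real p" by simp
  have single: "(\<lambda>j. (if j = 0 then x else 0) * h j) sums (x * h 0)" for x :: complex and h
    using sums_single[of 0 "\<lambda>j. x * h j"] by (auto elim!: back_subst[of "\<lambda>f. f sums _"])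
  have "?f \<in> class_A n p"
    unfolding class_A_def mem_Collect_eq
  proof (intro conjI exI ballI)
    show "?f holomorphic_on ball 0 1" by (intro holomorphic_intros)
    show "p_valent p ?f (ball 0 1)" by (rule trinomial_p_valent[OF params(1,2) c0 cp])
    show "(\<lambda>j. (if n + p + j = n + p then - of_real c else 0) * z ^ (n + p + j)) sums (?f z - z ^ p)" for z
      using single[of "- of_real c" "\<lambda>j. z ^ (n + p + j)"] by simp
  qed
  moreover have "subordinate (\<lambda>z. 1 / of_real (real p - \<sigma>) *
      (remove_sings (\<lambda>u. deriv (J_op n p \<delta> lam \<mu> l ?f) u / u ^ (p - 1)) z - of_real \<sigma>))
      (\<lambda>z. (1 + of_real A * z) / (1 + of_real B * z))"
  proof -
    define m where "m = (\<lambda>j::nat. if j = 0 then c else 0)"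
    define S :: "complex \<Rightarrow> complex" where "S = (\<lambda>t. \<Sum>j. of_real (J_coeff n p \<delta> lam \<mu> l j * m j) * t ^ (n + j))"
    have m: "(\<lambda>j. of_real (m j) * t ^ (n + p + j)) sums (t ^ p - ?f t)" for t
      using single[of "of_real c" "\<lambda>j. t ^ (n + p + j)"] by (simp add: m_def if_distrib cong: if_cong)
    define \<kappa> where "\<kappa> = (B - A) / (1 + B)"
    have S_eq: "S z = of_real (\<kappa> * (real p - \<sigma>)) * z ^ n" for z
    proof -
      have "(\<lambda>j. of_real (J_coeff n p \<delta> lam \<mu> l j * m j) * z ^ (n + j)) sums
          (of_real c * (of_real (J_coeff n p \<delta> lam \<mu> l 0) * z ^ (n + 0)))"
        using single[of "of_real c" "\<lambda>j. of_real (J_coeff n p \<delta> lam \<mu> l j) * z ^ (n + j)"]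
        by (rule back_subst[of "\<lambda>f. f sums _"]) (auto simp: m_def)
      then have "S z = of_real (c * J_coeff n p \<delta> lam \<mu> l 0) * z ^ n"
        by (simp add: S_def sums_iff)
      then show ?thesis unfolding c by (simp add: \<kappa>_def)
    qed
    have B0: "1 + complex_of_real B * z \<noteq> 0" if "norm z < 1" for z
    proof -
      have "norm (of_real B * z) < 1"
        using that AB mult_mono[of B 1 "norm z" "norm z"] by (simp add: norm_mult)
      then show ?thesis by (metis add_eq_0_iff norm_minus_cancel norm_one less_irrefl)
    qed
    have quot: "1 / of_real (real p - \<sigma>) *
        (remove_sings (\<lambda>u. deriv (J_op n p \<delta> lam \<mu> l ?f) u / u ^ (p - 1)) z - of_real \<sigma>) = 1 - of_real \<kappa> * z ^ n"
      if "z \<in> ball 0 1" for z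
    proof -
      have "complex_of_real (real p - \<sigma>) \<noteq> 0" using \<sigma> by (simp flip: of_real_diff)
      moreover have "of_nat p - of_real (\<kappa> * (real p - \<sigma>)) * z ^ n - of_real \<sigma> =
          complex_of_real (real p - \<sigma>) * (1 - of_real \<kappa> * z ^ n)" by (simp add: algebra_simps)
      ultimately show ?thesis
        unfolding remove_sings_deriv_J_op(3)[OF params m S_def that] S_eq by (simp only:) simp
    qed
    have "subordinate (\<lambda>z. 1 - of_real \<kappa> * z ^ n) (\<lambda>z. (1 + of_real A * z) / (1 + of_real B * z))"
      unfolding subordinate_def
    proof (intro conjI exI[of _ "\<lambda>z. z ^ n / (1 + of_real B - of_real B * z ^ n)"] ballI)
      have D: "norm (z ^ n) < norm (1 + of_real B - of_real B * z ^ n)" if "z \<in> ball 0 1" for z :: complex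
      proof -
        have zn: "norm (z ^ n) < 1" using norm_mult_power_less[OF params(1) zero_less_one that] by simp
        have "norm (z ^ n) < 1 + B - B * norm (z ^ n)"
          using zn AB mult_strict_left_mono[OF zn, of B] by linarith
        also have "\<dots> = norm (complex_of_real (1 + B)) - norm (of_real B * z ^ n)"
          using AB by (simp add: norm_mult del: of_real_add)
        also have "\<dots> \<le> norm (1 + of_real B - of_real B * z ^ n)"
          using norm_triangle_ineq2[of "complex_of_real (1 + B)" "of_real B * z ^ n"] by simp
        finally show ?thesis .
      qed
      then have D0: "1 + of_real B - of_real B * z ^ n \<noteq> 0" if "z \<in> ball 0 1" for z :: complex
        using that by (metis norm_zero norm_not_less_zero)
      show "(\<lambda>z. 1 - of_real \<kappa> * z ^ n) holomorphic_on ball 0 1" by (intro holomorphic_intros)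
      show "(\<lambda>z. (1 + of_real A * z) / (1 + of_real B * z)) holomorphic_on ball 0 1"
        by (intro holomorphic_intros) (use B0 in auto)
      show "(\<lambda>z. z ^ n / (1 + complex_of_real B - of_real B * z ^ n)) holomorphic_on ball 0 1"
        by (intro holomorphic_intros) (use D0 in auto)
      show "0 ^ n / (1 + complex_of_real B - of_real B * 0 ^ n) = 0" using params by simp
      fix z :: complex assume z: "z \<in> ball 0 1"
      show "norm (z ^ n / (1 + complex_of_real B - of_real B * z ^ n)) < 1"
        using D[OF z] D0[OF z] by (simp add: norm_divide pos_divide_less_eq)
      define d where "d = 1 + complex_of_real B - of_real B * z ^ n"
      have d0: "d \<noteq> 0" using D0[OF z] by (simp add: d_def)
      have B1: "1 + complex_of_real B \<noteq> 0"
        using AB by (metis add_pos_pos of_real_1 of_real_add of_real_eq_0_iff zero_less_one less_irrefl)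
      have 1: "1 + of_real B * (z ^ n / d) = (1 + of_real B) / d"
        using d0 by (simp add: field_simps) (simp add: d_def algebra_simps)
      have 2: "1 + of_real A * (z ^ n / d) = (1 + of_real B - of_real (B - A) * z ^ n) / d"
        using d0 by (simp add: field_simps) (simp add: d_def algebra_simps)
      have 3: "1 - of_real \<kappa> * z ^ n = (1 + of_real B - of_real (B - A) * z ^ n) / (1 + of_real B)"
        using B1 by (simp add: \<kappa>_def field_simps)
      show "1 - of_real \<kappa> * z ^ n = (1 + of_real A * (z ^ n / (1 + of_real B - of_real B * z ^ n))) /
          (1 + of_real B * (z ^ n / (1 + of_real B - of_real B * z ^ n)))"
        unfolding d_def[symmetric] 1 2 3 using d0 by simp
    qed
    then show ?thesis
      by (rule subordinate_cong[THEN iffD2, rotated]) (rule quot)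
  qed
  moreover have "\<exists>a :: nat \<Rightarrow> complex. \<forall>z\<in>ball 0 1.
       (\<lambda>j. of_real (norm (a (n + p + j))) * z ^ (n + p + j)) sums (z ^ p - ?f z)"
  proof (intro exI ballI)
    show "(\<lambda>j. of_real (norm (if n + p + j = n + p then complex_of_real c else 0)) * z ^ (n + p + j)) sums (z ^ p - ?f z)" for z
      using single[of "of_real c" "\<lambda>j. z ^ (n + p + j)"] c0 by (simp add: if_distrib cong: if_cong)
  qed
  ultimately show ?thesis
    unfolding class_P_tilde_def class_P_def by blast
qed

section \<open>The distortion bounds\<close>

text \<open>
  The factor by which \<open>f \<mapsto> z powr \<nu> * frac_deriv \<nu> (I_op \<theta> p f)\<close> multiplies \<open>z ^ (p + j)\<close>.
\<close>
definition DI_coeff :: "real \<Rightarrow> real \<Rightarrow> nat \<Rightarrow> nat \<Rightarrow> real" where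
  "DI_coeff \<nu> \<theta> p j = Gamma (real (p + j) + 1) / Gamma (real (p + j) + 1 - \<nu>) *
     ((\<theta> + real p) / (\<theta> + real p + real j))"

text \<open>
  The monomial \<open>z ^ p\<close> contributes the constant \<open>C0\<close> of the distortion bounds; the series is the deviation of the
  normalised fractional derivative from it.
\<close>
lemma frac_deriv_I_op_sums:
  assumes n: "n \<ge> 1" and p: "p \<ge> 1" and \<nu>: "\<nu> < 1" and \<theta>: "\<theta> > - real p"
    and f: "\<And>t. t \<in> ball 0 1 \<Longrightarrow> (\<lambda>j. of_real (m j) * t ^ (n + p + j)) sums (t ^ p - f t)"
    and z: "z \<in> ball 0 1" "z \<noteq> 0"
  shows "(\<lambda>j. of_real (DI_coeff \<nu> \<theta> p (n + j) * m j) * z ^ (n + j)) sums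
    (of_real (Gamma (real p + 1) / Gamma (real p + 1 - \<nu>)) -
      z powr of_real \<nu> / z ^ p * frac_deriv \<nu> (I_op \<theta> p f) z)"
proof -
  let ?D = "frac_deriv \<nu> (I_op \<theta> p f) z"
  let ?C0 = "Gamma (real p + 1) / Gamma (real p + 1 - \<nu>)"
  have "(\<lambda>j. of_real (m j) * t ^ (p + (n + j))) sums (t ^ p - f t)" if "t \<in> ball 0 1" for t
    using f[OF that] by (simp add: add_ac)
  then have "(\<lambda>j. gap_coeff n m j * t ^ (p + j)) sums f t" if "t \<in> ball 0 1" for t
    using gap_sums_iff[OF n, of m "\<lambda>j. t ^ (p + j)" "t ^ p - f t"] that by simp
  from frac_deriv_nz_powser[OF I_op_powser[OF this \<theta> p] \<nu> p z]
  have "(\<lambda>j. gap_coeff n m j * (of_real (DI_coeff \<nu> \<theta> p j) * z ^ (p + j))) sums (z powr of_real \<nu> * ?D)"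
    using z by (simp add: DI_coeff_def frac_deriv_def mult_ac)
  moreover have "DI_coeff \<nu> \<theta> p 0 = ?C0" using \<theta> by (simp add: DI_coeff_def)
  ultimately have "(\<lambda>j. of_real (m j) * (of_real (DI_coeff \<nu> \<theta> p (n + j)) * z ^ (p + (n + j)))) sums
      (of_real ?C0 * z ^ p - z powr of_real \<nu> * ?D)"
    using gap_sums_iff[OF n, of m "\<lambda>j. of_real (DI_coeff \<nu> \<theta> p j) * z ^ (p + j)"
        "of_real ?C0 * z ^ p - z powr of_real \<nu> * ?D"] by simp
  from sums_mult[OF this, of "inverse (z ^ p)"] z show ?thesis
    by (simp add: field_simps power_add)
qed

text \<open>
  Raising \<open>x\<close> by one multiplies the quotient by \<open>x / (x + 1 - \<nu>) \<le> 1\<close>.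
\<close>
lemma Gamma_ratio_antimono:
  assumes "x > 0" "\<nu> < 1" "0 \<le> \<nu>"
  shows "Gamma (x + real j) / Gamma (x + real j + 1 - \<nu>) \<le> Gamma x / Gamma (x + 1 - \<nu>)"
proof (induction j)
  case (Suc j)
  define y where "y = x + real j"
  have y: "y > 0" using assms by (simp add: y_def)
  have "Gamma (y + 1) = y * Gamma y" "Gamma (y + 1 - \<nu> + 1) = (y + 1 - \<nu>) * Gamma (y + 1 - \<nu>)"
    by (rule Gamma_plus1; use y assms in \<open>auto simp: nonpos_Ints_def\<close>)+
  then have "Gamma (y + 1) / Gamma (y + 1 + 1 - \<nu>) = y / (y + 1 - \<nu>) * (Gamma y / Gamma (y + 1 - \<nu>))"
    by (simp add: algebra_simps)
  also have "\<dots> \<le> 1 * (Gamma y / Gamma (y + 1 - \<nu>))"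
    using y assms by (intro mult_right_mono divide_nonneg_nonneg less_imp_le[OF Gamma_real_pos]) auto
  finally show ?case using Suc.IH by (simp add: y_def add_ac)
qed simp

text \<open>
  Writing \<open>\<Gamma>(k + 1) = k \<Gamma>(k)\<close> with \<open>k = n + p + j\<close>, the quotient of the left side by
  \<open>k \<Phi>\<^sub>k\<close> is a product of three nonincreasing functions of \<open>k\<close>, and the right side replaces each by its value at
  \<open>k = n + p\<close>.
\<close>
lemma DI_coeff_le:
  assumes "n \<ge> 1" "p \<ge> 1" "\<mu> \<ge> 0" "lam \<ge> \<mu>" "l \<ge> 0" "\<delta> \<ge> 0"
    and \<nu>: "0 \<le> \<nu>" "\<nu> < 1" and \<theta>: "\<theta> > - real p"
  shows "DI_coeff \<nu> \<theta> p (n + j) \<le>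
      (\<theta> + real p) * Gamma (real n + real p) /
        ((\<theta> + real n + real p) * Gamma (real n + real p + 1 - \<nu>) * Phi p (n + p) \<delta> lam \<mu> l) *
      J_coeff n p \<delta> lam \<mu> l j" (is "?lhs \<le> ?rhs")
    and "DI_coeff \<nu> \<theta> p (n + j) \<ge> 0"
proof -
  define x where "x = real n + real p"
  have x: "x > 0" using assms by (simp add: x_def)
  define \<Phi> where "\<Phi> = (\<lambda>j. Phi p (n + p + j) \<delta> lam \<mu> l)"
  have \<Phi>0: "\<Phi> 0 > 0" using Phi_ge_1[OF assms(2-6), of "n + p"] by (simp add: \<Phi>_def)
  have \<Phi>: "1 \<le> \<Phi> j / \<Phi> 0"
    using Phi_mono[OF assms(2-6), of "n + p" "n + p + j"] \<Phi>0 by (simp add: \<Phi>_def)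
  have Gp: "Gamma (x + real j) / Gamma (x + real j + 1 - \<nu>) \<ge> 0"
    using x \<nu> by (intro divide_nonneg_nonneg less_imp_le[OF Gamma_real_pos]) auto
  have "Gamma (x + real j + 1) = (x + real j) * Gamma (x + real j)"
    using x by (intro Gamma_plus1) (auto simp: nonpos_Ints_def)
  then have eq: "?lhs = (\<theta> + real p) / (\<theta> + x + real j) *
      (Gamma (x + real j) / Gamma (x + real j + 1 - \<nu>)) * (x + real j)"
    by (simp add: DI_coeff_def x_def add_ac mult_ac)
  show "?lhs \<ge> 0"
    unfolding eq using \<theta> x by (intro mult_nonneg_nonneg[OF mult_nonneg_nonneg[OF divide_nonneg_nonneg Gp]]) (auto simp: x_def)
  have "?lhs \<le> (\<theta> + real p) / (\<theta> + x) * (Gamma x / Gamma (x + 1 - \<nu>)) * (x + real j)"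
    unfolding eq
  proof (intro mult_right_mono mult_mono Gamma_ratio_antimono x \<nu> Gp)
    show "(\<theta> + real p) / (\<theta> + x + real j) \<le> (\<theta> + real p) / (\<theta> + x)"
      using \<theta> assms by (intro divide_left_mono mult_pos_pos) (auto simp: x_def)
    show "0 \<le> (\<theta> + real p) / (\<theta> + x)"
      using \<theta> assms by (intro divide_nonneg_nonneg) (auto simp: x_def)
    show "0 \<le> x + real j" using x by simp
  qed
  also have "\<dots> \<le> (\<theta> + real p) / (\<theta> + x) * (Gamma x / Gamma (x + 1 - \<nu>)) * (x + real j) * (\<Phi> j / \<Phi> 0)"
  proof -
    have "0 \<le> (\<theta> + real p) / (\<theta> + x) * (Gamma x / Gamma (x + 1 - \<nu>)) * (x + real j)"
      using \<theta> x \<nu> by (intro mult_nonneg_nonneg divide_nonneg_nonneg less_imp_le[OF Gamma_real_pos]) (auto simp: x_def)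
    from mult_left_mono[OF \<Phi> this] show ?thesis by simp
  qed
  also have "\<dots> = ?rhs"
    by (simp add: x_def \<Phi>_def J_coeff_def add_ac mult_ac)
  finally show "?lhs \<le> ?rhs" .
qed

theorem theorem7p2:
  fixes n p :: nat and lam \<mu> l \<delta> A B \<sigma> \<nu> \<theta> :: real
  assumes "n \<ge> 1" "p \<ge> 1"
    and "\<mu> \<ge> 0" "lam \<ge> \<mu>" "l \<ge> 0" "\<delta> \<ge> 0"
    and "- 1 \<le> A" "A < B" "B \<le> 1" "0 < B"
    and "0 \<le> \<sigma>" "\<sigma> < real p"
    and "0 \<le> \<nu>" "\<nu> < 1" "\<theta> > - real p"
  shows "let C0 = Gamma (real p + 1) / Gamma (real p + 1 - \<nu>);
             C1 = ((\<theta> + real p) * Gamma (real n + real p) * (B - A) * (real p - \<sigma>)) /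
                  ((\<theta> + real n + real p) * Gamma (real n + real p + 1 - \<nu>) * (1 + B) *
                     Phi p (n + p) \<delta> lam \<mu> l);
             lower = (\<lambda>z :: complex. (C0 - C1 * norm z ^ n) * norm z powr (real p - \<nu>));
             upper = (\<lambda>z :: complex. (C0 + C1 * norm z ^ n) * norm z powr (real p - \<nu>));
             D = (\<lambda>f. frac_deriv \<nu> (I_op \<theta> p f));
             K = class_P_tilde n p \<delta> lam \<mu> l A B \<sigma>
         in (\<forall>f\<in>K. \<forall>z\<in>ball 0 1. norm (D f z) \<ge> lower z) \<and>
            (\<forall>f\<in>K. \<forall>z\<in>ball 0 1. norm (D f z) \<le> upper z) \<and>
            (\<exists>f\<in>K. \<exists>z\<in>ball 0 1. z \<noteq> 0 \<and> norm (D f z) = lower z) \<and>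
            (\<exists>f\<in>K. \<exists>z\<in>ball 0 1. z \<noteq> 0 \<and> norm (D f z) = upper z)"
proof -
  note params = assms(1-6) and AB = assms(7-10) and \<sigma> = assms(11,12) and \<nu> = assms(13,14) and \<theta> = assms(15)
  define C0 where "C0 = Gamma (real p + 1) / Gamma (real p + 1 - \<nu>)"
  define C1 where "C1 = ((\<theta> + real p) * Gamma (real n + real p) * (B - A) * (real p - \<sigma>)) /
                  ((\<theta> + real n + real p) * Gamma (real n + real p + 1 - \<nu>) * (1 + B) *
                     Phi p (n + p) \<delta> lam \<mu> l)"
  define D where "D = (\<lambda>f. frac_deriv \<nu> (I_op \<theta> p f))"
  define K where "K = class_P_tilde n p \<delta> lam \<mu> l A B \<sigma>"
  define \<beta> where "\<beta> = (B - A) * (real p - \<sigma>) / (1 + B)"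
  define M where "M = (\<theta> + real p) * Gamma (real n + real p) /
        ((\<theta> + real n + real p) * Gamma (real n + real p + 1 - \<nu>) * Phi p (n + p) \<delta> lam \<mu> l)"
  have C1: "C1 = M * \<beta>" by (simp add: C1_def M_def \<beta>_def mult_ac)
  have C0_pos: "C0 > 0"
    unfolding C0_def using assms by (intro divide_pos_pos Gamma_real_pos) auto
  have \<Phi>_pos: "Phi p (n + p) \<delta> lam \<mu> l > 0"
    using Phi_ge_1[OF assms(2-6), of "n + p"] by simp
  have M_pos: "M > 0"
    unfolding M_def using assms \<Phi>_pos by (intro divide_pos_pos mult_pos_pos Gamma_real_pos) auto
  have \<beta>_pos: "\<beta> > 0"
    unfolding \<beta>_def using AB \<sigma> by (intro divide_pos_pos mult_pos_pos) auto
  have norm_D: "norm (D f z) = norm (of_real C0 - T) * norm z powr (real p - \<nu>)"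
    if T: "T = of_real C0 - z powr of_real \<nu> / z ^ p * D f z" and z: "z \<noteq> 0" for f z T
  proof -
    have "D f z = (of_real C0 - T) * (z ^ p / z powr of_real \<nu>)" using z by (simp add: T)
    moreover have "norm (z ^ p / z powr of_real \<nu>) = norm z powr (real p - \<nu>)"
      using z by (simp add: norm_divide norm_power norm_powr_real_powr' powr_diff powr_realpow)
    ultimately show ?thesis by (simp only: norm_mult)
  qed
  have bounds: "(C0 - C1 * norm z ^ n) * norm z powr (real p - \<nu>) \<le> norm (D f z)"
      "norm (D f z) \<le> (C0 + C1 * norm z ^ n) * norm z powr (real p - \<nu>)"
    if f: "f \<in> K" and z: "z \<in> ball 0 1" "z \<noteq> 0" for f z
  proof -
    obtain m where m: "\<And>j. m j \<ge> 0"
      "\<And>t. t \<in> ball 0 1 \<Longrightarrow> (\<lambda>j. of_real (m j) * t ^ (n + p + j)) sums (t ^ p - f t)"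
      "summable (\<lambda>j. J_coeff n p \<delta> lam \<mu> l j * m j)"
      "(\<Sum>j. J_coeff n p \<delta> lam \<mu> l j * m j) \<le> \<beta>"
      using class_P_tilde_coeff_bound[OF params AB \<sigma>(2) f[unfolded K_def]] unfolding \<beta>_def by blast
    define T where "T = of_real C0 - z powr of_real \<nu> / z ^ p * D f z"
    have T: "(\<lambda>j. of_real (DI_coeff \<nu> \<theta> p (n + j) * m j) * z ^ (n + j)) sums T"
      unfolding T_def D_def C0_def
      by (rule frac_deriv_I_op_sums[OF params(1,2) \<nu>(2) \<theta> m(2) z])
    have le: "norm (of_real (DI_coeff \<nu> \<theta> p (n + j) * m j) * z ^ (n + j)) \<le>
        M * norm z ^ n * (J_coeff n p \<delta> lam \<mu> l j * m j)" for j
    proof -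
      note DI = DI_coeff_le[OF params \<nu> \<theta>, of j, folded M_def]
      have "DI_coeff \<nu> \<theta> p (n + j) * m j \<le> M * J_coeff n p \<delta> lam \<mu> l j * m j"
        using DI(1) m(1)[of j] by (rule mult_right_mono)
      moreover have "norm z ^ (n + j) \<le> norm z ^ n"
        by (rule power_decreasing) (use z in auto)
      ultimately have "DI_coeff \<nu> \<theta> p (n + j) * m j * norm z ^ (n + j) \<le>
          M * J_coeff n p \<delta> lam \<mu> l j * m j * norm z ^ n"
        using DI m(1)[of j] by (intro mult_mono) (auto intro: order_trans)
      then show ?thesis
        using DI(2) m(1)[of j] by (simp add: norm_mult norm_power mult_ac)
    qed
    have "norm T \<le> (\<Sum>j. M * norm z ^ n * (J_coeff n p \<delta> lam \<mu> l j * m j))"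
      using norm_suminf_le[OF le summable_mult[OF m(3)]] T by (simp add: sums_iff)
    also have "\<dots> = M * norm z ^ n * (\<Sum>j. J_coeff n p \<delta> lam \<mu> l j * m j)"
      by (rule suminf_mult[OF m(3)])
    also have "\<dots> \<le> M * norm z ^ n * \<beta>"
      using m(4) M_pos by (intro mult_left_mono) auto
    finally have nT: "norm T \<le> C1 * norm z ^ n" by (simp add: C1 mult_ac)
    have "C0 - C1 * norm z ^ n \<le> norm (of_real C0 - T)"
      using norm_triangle_ineq2[of "of_real C0" T] nT C0_pos by simp
    moreover have "norm (of_real C0 - T) \<le> C0 + C1 * norm z ^ n"
      using norm_triangle_ineq4[of "of_real C0" T] nT C0_pos by simp
    ultimately show "(C0 - C1 * norm z ^ n) * norm z powr (real p - \<nu>) \<le> norm (D f z)"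
      "norm (D f z) \<le> (C0 + C1 * norm z ^ n) * norm z powr (real p - \<nu>)"
      unfolding norm_D[OF T_def z(2)] by (auto intro: mult_right_mono)
  qed
  \<comment> \<open>At the origin the upper bound tends to \<open>0\<close>, because \<open>p - \<nu> > 0\<close>, and so does the derivative.\<close>
  have D_0: "D f 0 = 0" if f: "f \<in> K" for f
  proof -
    have "((\<lambda>z. D f z) \<longlongrightarrow> 0) (at 0)"
    proof (rule Lim_null_comparison)
      have np: "real p - \<nu> > 0" using params(2) \<nu> by linarith
      have n0: "(norm \<longlongrightarrow> 0) (at (0::complex))" by (rule tendsto_norm_zero) simp
      have "((\<lambda>z::complex. (C0 + C1 * norm z ^ n) * norm z powr (real p - \<nu>)) \<longlongrightarrow>
          (C0 + C1 * norm (0::complex) ^ n) * norm (0::complex) powr (real p - \<nu>)) (at 0)"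
        using np n0 by (intro tendsto_intros tendsto_powr' disjI2) auto
      then show "((\<lambda>z::complex. (C0 + C1 * norm z ^ n) * norm z powr (real p - \<nu>)) \<longlongrightarrow> 0) (at 0)"
        by simp
      have "eventually (\<lambda>z. z \<in> ball 0 1 - {0}) (at (0::complex))"
        by (rule eventually_at_in_open) auto
      then show "eventually (\<lambda>z. norm (D f z) \<le> (C0 + C1 * norm z ^ n) * norm z powr (real p - \<nu>)) (at 0)"
        by eventually_elim (use bounds(2)[OF f] in auto)
    qed
    then have "(frac_deriv_nz \<nu> (I_op \<theta> p f) \<longlongrightarrow> 0) (at 0)"
      by (rule Lim_transform_eventually)
         (auto simp: D_def frac_deriv_def eventually_at intro: exI[of _ 1])
    then show ?thesis by (simp add: D_def frac_deriv_def tendsto_Lim)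
  qed
  \<comment> \<open>The whole admissible coefficient mass \<open>\<beta>\<close> is put on the first index.\<close>
  define c where "c = \<beta> / J_coeff n p \<delta> lam \<mu> l 0"
  define f where "f = (\<lambda>z::complex. z ^ p - of_real c * z ^ (n + p))"
  have J0: "J_coeff n p \<delta> lam \<mu> l 0 > 0" using \<Phi>_pos params by (simp add: J_coeff_def)
  have f: "f \<in> K"
    unfolding f_def K_def
    by (rule trinomial_in_class_P_tilde[OF params AB \<sigma>]) (use J0 in \<open>simp add: c_def \<beta>_def\<close>)
  have norm_Df: "norm (D f z) = norm (of_real C0 - of_real C1 * z ^ n) * norm z powr (real p - \<nu>)"
    if z: "z \<in> ball 0 1" "z \<noteq> 0" for z
  proof (rule norm_D[OF _ z(2)])
    define m where "m = (\<lambda>j::nat. if j = 0 then c else 0)"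
    have single: "(\<lambda>j. of_real (h j * m j) * z ^ (k + j)) sums (of_real (h 0 * c) * z ^ k)" for h k and z :: complex
      using sums_single[of 0 "\<lambda>j. of_real (h j * c) * z ^ (k + j)"]
      by (auto elim!: back_subst[of "\<lambda>f. f sums _"] simp: m_def)
    have "(\<lambda>j. of_real (m j) * t ^ (n + p + j)) sums (t ^ p - f t)" for t
      using single[of "\<lambda>_. 1"] by (simp add: f_def)
    from frac_deriv_I_op_sums[OF params(1,2) \<nu>(2) \<theta> this z]
    have "of_real (DI_coeff \<nu> \<theta> p n * c) * z ^ n = of_real C0 - z powr of_real \<nu> / z ^ p * D f z"
      using single[of "\<lambda>j. DI_coeff \<nu> \<theta> p (n + j)" z n] unfolding D_def C0_def
      by (intro sums_unique2) auto
    moreover have "DI_coeff \<nu> \<theta> p n * c = C1"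
    proof -
      have "Gamma (real n + real p + 1) = (real n + real p) * Gamma (real n + real p)"
        using params by (intro Gamma_plus1) (auto simp: nonpos_Ints_def)
      then have "DI_coeff \<nu> \<theta> p n = M * J_coeff n p \<delta> lam \<mu> l 0"
        using \<Phi>_pos by (simp add: DI_coeff_def M_def J_coeff_def add_ac mult_ac)
      then show ?thesis using J0 by (simp add: C1 c_def)
    qed
    ultimately show "of_real C1 * z ^ n = of_real C0 - z powr of_real \<nu> / z ^ p * D f z"
      by simp
  qed
  have C1_pos: "C1 > 0" using M_pos \<beta>_pos by (simp add: C1)
  have "\<exists>z\<in>ball 0 1. z \<noteq> 0 \<and> norm (D f z) = (C0 - C1 * norm z ^ n) * norm z powr (real p - \<nu>)"
  proof -
    \<comment> \<open>The radius is small enough for \<open>C0 - C1 r ^ n\<close> to be its own modulus.\<close>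
    define r where "r = min (1 / 2) (C0 / C1)"
    have r: "0 < r" "r < 1" "C1 * r \<le> C0"
      using C0_pos C1_pos by (auto simp: r_def min_def field_simps)
    have "r ^ n \<le> r ^ 1" by (rule power_decreasing) (use r params in auto)
    then have "C1 * r ^ n \<le> C1 * r" using C1_pos by (intro mult_left_mono) auto
    then have "C1 * r ^ n \<le> C0" using r(3) by linarith
    moreover have "of_real C0 - of_real C1 * of_real r ^ n = complex_of_real (C0 - C1 * r ^ n)" by simp
    ultimately have "norm (of_real C0 - of_real C1 * complex_of_real r ^ n) = C0 - C1 * r ^ n"
      by (simp only: norm_of_real)
    then have "norm (D f (of_real r)) = (C0 - C1 * norm (complex_of_real r) ^ n) * norm (complex_of_real r) powr (real p - \<nu>)"
      using norm_Df[of "of_real r"] r by simp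
    then show ?thesis using r by (intro bexI[of _ "of_real r"]) auto
  qed
  moreover have "\<exists>z\<in>ball 0 1. z \<noteq> 0 \<and> norm (D f z) = (C0 + C1 * norm z ^ n) * norm z powr (real p - \<nu>)"
  proof -
    \<comment> \<open>At this argument \<open>z ^ n\<close> is negative, so the two terms add up.\<close>
    define z where "z = rcis (1 / 2) (pi / real n)"
    have z: "norm z = 1 / 2" by (simp add: z_def)
    then have zb: "z \<in> ball 0 1" "z \<noteq> 0" by auto
    have "z ^ n = - of_real ((1 / 2) ^ n)"
      using params unfolding z_def DeMoivre2 by (simp add: rcis_def)
    then have "of_real C0 - of_real C1 * z ^ n = complex_of_real (C0 + C1 * norm z ^ n)"
      by (simp add: z)
    moreover have "C0 + C1 * norm z ^ n \<ge> 0" using C0_pos C1_pos by simp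
    ultimately have "norm (of_real C0 - of_real C1 * z ^ n) = C0 + C1 * norm z ^ n"
      by (simp only: norm_of_real)
    then show ?thesis using norm_Df[OF zb] zb by (intro bexI[of _ z]) auto
  qed
  moreover have "\<forall>f\<in>K. \<forall>z\<in>ball 0 1. (C0 - C1 * norm z ^ n) * norm z powr (real p - \<nu>) \<le> norm (D f z)"
  proof (intro ballI)
    fix f z assume "f \<in> K" "z \<in> ball (0::complex) 1"
    then show "(C0 - C1 * norm z ^ n) * norm z powr (real p - \<nu>) \<le> norm (D f z)"
      using bounds(1) D_0 by (cases "z = 0") auto
  qed
  moreover have "\<forall>f\<in>K. \<forall>z\<in>ball 0 1. norm (D f z) \<le> (C0 + C1 * norm z ^ n) * norm z powr (real p - \<nu>)"
  proof (intro ballI)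
    fix f z assume "f \<in> K" "z \<in> ball (0::complex) 1"
    then show "norm (D f z) \<le> (C0 + C1 * norm z ^ n) * norm z powr (real p - \<nu>)"
      using bounds(2) D_0 by (cases "z = 0") auto
  qed
  ultimately show ?thesis
    using f unfolding Let_def C0_def[symmetric] C1_def[symmetric] K_def[symmetric] D_def[symmetric, THEN fun_cong]
    unfolding D_def by blast
qed

end
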